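(* For any probability distribution $\mu=(\mu_k)_{k\ge 0}$ on $\mathbb{N}=\{0,1,2,\dots\}$ with $\mu_0+\mu_1<1$, one has $\mathbf{E}[\mathrm{ht}(\mathrm{T}_{\mu,n})]=O(n^{1/2})$ and, more generally, for any fixed $r\in(0,\infty)$, $\mathbf{E}[\mathrm{ht}(\mathrm{T}_{\mu,n})^r]=O(n^{r/2})$, as $n\to\infty$ over all $n$ such that $\mathbf{P}(|\mathrm{T}_\mu|=n)>0$.
   Context: A plane tree is a rooted, unlabeled finite tree in which the set of children of each node carries a (left-to-right) total order. $\mathrm{T}_\mu$ is the Bienaymé (Galton–Watson) tree with offspring distribution $\mu$, i.e. the family tree of a branching process with offspring distribution $\mu$; for every finite plane tree $\mathrm{t}$, $\mathbf{P}(\mathrm{T}_\mu=\mathrm{t})=\prod_{v}\mu_{d_{\mathrm{t}}(v)}$, where the product is over vertices $v$ of $\mathrm{t}$ and $d_{\mathrm{t}}(v)$ is the number of children of $v$. $|\mathrm{T}_\mu|$ is its number of vertices, and for $n$ with $\mathbf{P}(|\mathrm{T}_\mu|=n)>0$, $\mathrm{T}_{\mu,n}$ is $\mathrm{T}_\mu$ conditioned to have exactly $n$ vertices. The height $\mathrm{ht}(\mathrm{t})$ is the maximum graph distance from the root to a vertex of $\mathrm{t}$. Implied constants may depend on $\mu$ and $r$. *)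

theory Defs
  imports "HOL-Probability.Probability" "HOL-Library.Landau_Symbols"
begin

text \<open>
  Plane trees are represented as Ulam--Harris sets of words: the root is \<open>[]\<close> and \<open>v @ [i]\<close> is
  the child of \<open>v\<close> with index \<open>i\<close> (counting from 0) in left-to-right order.
  \<open>family_tree K\<close> is the (possibly infinite) tree in which a vertex \<open>v\<close> has \<open>K v\<close> children.
\<close>

inductive_set family_tree :: "(nat list \<Rightarrow> nat) \<Rightarrow> nat list set"
  for K :: "nat list \<Rightarrow> nat" where
  root: "[] \<in> family_tree K"
| child: "v \<in> family_tree K \<Longrightarrow> i < K v \<Longrightarrow> v @ [i] \<in> family_tree K"

definition plane_tree :: "nat list set \<Rightarrow> bool" where
  "plane_tree t \<longleftrightarrow> finite t \<and> (\<exists>K. t = family_tree K)"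

definition num_children :: "nat list set \<Rightarrow> nat list \<Rightarrow> nat" where
  "num_children t v = card {i. v @ [i] \<in> t}"

text \<open>The length of a word is its graph distance to the root.\<close>

definition tree_height :: "nat list set \<Rightarrow> nat" where
  "tree_height t = Max (length ` t)"

text \<open>
  The Galton--Watson tree with offspring distribution \<open>\<mu>\<close> is the random variable \<open>family_tree\<close>
  on the following probability space of i.i.d. offspring numbers; it may be infinite with
  positive probability.
\<close>

definition offspring_space :: "nat pmf \<Rightarrow> (nat list \<Rightarrow> nat) measure" where
  "offspring_space \<mu> = PiM UNIV (\<lambda>_. measure_pmf \<mu>)"

definition size_event :: "nat \<Rightarrow> (nat list \<Rightarrow> nat) set" where
  "size_event n = {K. finite (family_tree K) \<and> card (family_tree K) = n}"

definition attainable_sizes :: "nat pmf \<Rightarrow> nat set" where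
  "attainable_sizes \<mu> = {n. measure (offspring_space \<mu>) (size_event n) > 0}"

text \<open>
  The conditioned tree is \<open>family_tree\<close> on the same space, conditioned on the size event.
\<close>

definition conditioned_space :: "nat pmf \<Rightarrow> nat \<Rightarrow> (nat list \<Rightarrow> nat) measure" where
  "conditioned_space \<mu> n = uniform_measure (offspring_space \<mu>) (size_event n)"

lemma prob_space_offspring_space: "prob_space (offspring_space \<mu>)"
  unfolding offspring_space_def by (intro prob_space_PiM measure_pmf.prob_space_axioms)

lemma sets_offspring_space: "sets (offspring_space \<mu>) = sets (PiM UNIV (\<lambda>_. count_space UNIV))"
  unfolding offspring_space_def by (intro sets_PiM_cong) auto

lemma space_offspring_space [simp]: "space (offspring_space \<mu>) = UNIV"
  by (simp add: offspring_space_def space_PiM)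

lemma measurable_offspring [measurable]:
  "(\<lambda>K. K v) \<in> offspring_space \<mu> \<rightarrow>\<^sub>M count_space UNIV"
  unfolding measurable_cong_sets[OF sets_offspring_space refl]
  by (rule measurable_component_singleton) simp

lemma snoc_mem_family_tree_iff:
  "v @ [i] \<in> family_tree K \<longleftrightarrow> v \<in> family_tree K \<and> i < K v"
  by (auto intro: family_tree.intros elim: family_tree.cases)

lemma num_children_family_tree:
  "v \<in> family_tree K \<Longrightarrow> num_children (family_tree K) v = K v"
  by (simp add: num_children_def snoc_mem_family_tree_iff)

lemma family_tree_eq_iff:
  assumes "plane_tree t"
  shows "family_tree K = t \<longleftrightarrow> (\<forall>v\<in>t. K v = num_children t v)"
proof -
  obtain L where t: "t = family_tree L"
    using assms by (auto simp: plane_tree_def)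
  show ?thesis
  proof
    assume "family_tree K = t"
    then show "\<forall>v\<in>t. K v = num_children t v"
      using num_children_family_tree[of _ K] by auto
  next
    assume "\<forall>v\<in>t. K v = num_children t v"
    then have eq: "K v = L v" if "v \<in> family_tree L" for v
      using that by (simp add: t num_children_family_tree)
    have "v \<in> family_tree K \<longleftrightarrow> v \<in> family_tree L" for v
      by (induction v rule: rev_induct) (auto simp: snoc_mem_family_tree_iff eq intro: family_tree.root)
    then show "family_tree K = t"
      by (auto simp: t)
  qed
qed

lemma prob_family_tree_eq:
  assumes "plane_tree t"
  shows "measure (offspring_space \<mu>) {K. family_tree K = t} = (\<Prod>v\<in>t. pmf \<mu> (num_children t v))"
proof -
  interpret product_prob_space "\<lambda>_. measure_pmf \<mu>" "UNIV :: nat list set"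
    by unfold_locales
  have "finite t"
    using assms by (simp add: plane_tree_def)
  have "{K. family_tree K = t} =
      prod_emb UNIV (\<lambda>_. measure_pmf \<mu>) t (\<Pi>\<^sub>E v\<in>t. {num_children t v})"
    using family_tree_eq_iff[OF assms] by (auto simp: prod_emb_def PiE_iff)
  then show ?thesis
    using measure_PiM_emb[of t "\<lambda>v. {num_children t v}"] \<open>finite t\<close>
    by (simp add: offspring_space_def measure_pmf_single)
qed

lemma measurable_finite_family_tree:
  "(\<lambda>K. if finite (family_tree K) then family_tree K else UNIV)
    \<in> offspring_space \<mu> \<rightarrow>\<^sub>M count_space (insert UNIV (Collect finite))"
  (is "?h \<in> _")
proof (subst measurable_count_space_eq_countable, safe)
  let ?M = "offspring_space \<mu>"
  show "countable (insert UNIV (Collect finite) :: nat list set set)"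
    by (simp add: countable_Collect_finite)
  have fin: "{K. family_tree K = t} \<in> sets ?M" if "finite t" for t
  proof (cases "plane_tree t")
    case True
    have "{K \<in> space ?M. \<forall>v\<in>t. K v = num_children t v} \<in> sets ?M"
      using \<open>finite t\<close> by measurable
    then show ?thesis
      by (simp add: family_tree_eq_iff[OF True])
  next
    case False
    then have "{K. family_tree K = t} = {}"
      using that by (auto simp: plane_tree_def)
    then show ?thesis
      by simp
  qed
  have inf: "\<not> finite (UNIV :: nat list set)"
    by (rule infinite_UNIV_listI)
  have "(\<Union>t\<in>Collect finite. {K. family_tree K = t}) \<in> sets ?M"
    by (intro sets.countable_UN' countable_Collect_finite) (auto simp: fin)
  also have "(\<Union>t\<in>Collect finite. {K. family_tree K = t}) = {K. finite (family_tree K)}"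
    by blast
  finally have "space ?M - {K. finite (family_tree K)} \<in> sets ?M"
    by (rule sets.compl_sets)
  moreover have "?h K = UNIV \<longleftrightarrow> \<not> finite (family_tree K)" for K
    using inf by (cases "finite (family_tree K)") (simp, metis, simp)
  then have "?h -` {UNIV} \<inter> space ?M = space ?M - {K. finite (family_tree K)}"
    unfolding vimage_def by auto
  ultimately show "?h -` {UNIV} \<inter> space ?M \<in> sets ?M"
    by simp
  fix t :: "nat list set" assume "finite t"
  then have "?h K = t \<longleftrightarrow> family_tree K = t" for K
    using inf by (cases "finite (family_tree K)") (simp, metis)
  then have "?h -` {t} \<inter> space ?M = {K. family_tree K = t}"
    unfolding vimage_def by simp
  then show "?h -` {t} \<inter> space ?M \<in> sets ?M"
    using fin[OF \<open>finite t\<close>] by simp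
qed auto

lemma size_event_measurable [measurable]: "size_event n \<in> sets (offspring_space \<mu>)"
proof -
  have "{t. finite t \<and> card t = n} \<subseteq> insert UNIV (Collect finite :: nat list set set)"
    by auto
  then have "(\<lambda>K. if finite (family_tree K) then family_tree K else UNIV) -` {t. finite t \<and> card t = n}
      \<inter> space (offspring_space \<mu>) \<in> sets (offspring_space \<mu>)"
    by (intro measurable_sets[OF measurable_finite_family_tree]) simp
  also have "(\<lambda>K. if finite (family_tree K) then family_tree K else UNIV) -` {t. finite t \<and> card t = n}
      \<inter> space (offspring_space \<mu>) = size_event n"
    using infinite_UNIV_listI[where 'a = nat] by (simp add: size_event_def vimage_def if_distrib cong: if_cong) blast
  finally show ?thesis .
qed

lemma prob_space_conditioned_space:
  assumes "n \<in> attainable_sizes \<mu>"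
  shows "prob_space (conditioned_space \<mu> n)"
proof -
  interpret prob_space "offspring_space \<mu>"
    by (rule prob_space_offspring_space)
  show ?thesis
    unfolding conditioned_space_def
    using assms by (intro prob_space_uniform_measure)
      (simp_all add: attainable_sizes_def emeasure_eq_measure)
qed

lemma infinite_length_image_family_tree:
  assumes "infinite (family_tree K)"
  shows "infinite (length ` family_tree K)"
proof
  assume "finite (length ` family_tree K)"
  moreover have "finite {v \<in> family_tree K. length v = m}" for m
  proof (induction m)
    case 0
    show ?case by (rule finite_subset[of _ "{[]}"]) auto
  next
    case (Suc m)
    have "{v \<in> family_tree K. length v = Suc m}
        \<subseteq> (\<Union>u\<in>{v \<in> family_tree K. length v = m}. (\<lambda>i. u @ [i]) ` {..<K u})"
    proof
      fix v assume v: "v \<in> {v \<in> family_tree K. length v = Suc m}"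
      then show "v \<in> (\<Union>u\<in>{v \<in> family_tree K. length v = m}. (\<lambda>i. u @ [i]) ` {..<K u})"
        by (cases v rule: rev_cases) (auto simp: snoc_mem_family_tree_iff)
    qed
    then show ?case
      by (rule finite_subset) (use Suc in auto)
  qed
  ultimately have "finite (\<Union>m\<in>length ` family_tree K. {v \<in> family_tree K. length v = m})"
    by blast
  moreover have "family_tree K \<subseteq> (\<Union>m\<in>length ` family_tree K. {v \<in> family_tree K. length v = m})"
    by auto
  ultimately show False
    using assms finite_subset by blast
qed

lemma Max_infinite: "infinite A \<Longrightarrow> infinite B \<Longrightarrow> Max A = Max B"
  by (simp add: Max.eq_fold')

lemma measurable_height_family_tree [measurable]:
  "(\<lambda>K. tree_height (family_tree K)) \<in> offspring_space \<mu> \<rightarrow>\<^sub>M count_space UNIV"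
proof -
  have "length (replicate m (0::nat)) = m" for m
    by simp
  then have "range (length :: nat list \<Rightarrow> nat) = UNIV"
    by (intro surjI)
  then have inf: "infinite (range (length :: nat list \<Rightarrow> nat))"
    by simp
  have "tree_height (family_tree K) = tree_height (if finite (family_tree K) then family_tree K else UNIV)" for K
    unfolding tree_height_def
    using Max_infinite[OF infinite_length_image_family_tree inf] by simp
  then have *: "(\<lambda>K. tree_height (family_tree K)) =
      (\<lambda>K. tree_height (if finite (family_tree K) then family_tree K else UNIV))"
    by (rule ext)
  show ?thesis
    unfolding * by (rule measurable_compose[OF measurable_finite_family_tree]) simp
qed

lemma family_tree_appendD: "u @ w \<in> family_tree K \<Longrightarrow> u \<in> family_tree K"
proof (induction w rule: rev_induct)
  case (snoc i w)
  then show ?case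
    using snoc_mem_family_tree_iff[of "u @ w" i K] by simp
qed simp

lemma height_less_card:
  assumes "finite (family_tree K)"
  shows "tree_height (family_tree K) < card (family_tree K)"
proof -
  have "tree_height (family_tree K) \<in> length ` family_tree K"
    unfolding tree_height_def using assms family_tree.root by (intro Max_in) auto
  then obtain v where v: "v \<in> family_tree K" "length v = tree_height (family_tree K)"
    by auto
  have "inj_on (\<lambda>m. take m v) {..length v}"
    by (rule inj_on_inverseI[where g = length]) simp
  moreover have "(\<lambda>m. take m v) ` {..length v} \<subseteq> family_tree K"
    using v(1) by (auto intro!: family_tree_appendD[of "take m v" "drop m v" for m])
  ultimately have "card {..length v} \<le> card (family_tree K)"
    using assms by (intro card_inj_on_le)
  then show ?thesis
    by (simp add: v(2))
qed

lemma integrable_height_powr: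
  assumes "n \<in> attainable_sizes \<mu>" and "r \<ge> 0"
  shows "integrable (conditioned_space \<mu> n) (\<lambda>K. real (tree_height (family_tree K)) powr r)"
proof -
  interpret prob_space "conditioned_space \<mu> n"
    using assms by (intro prob_space_conditioned_space)
  have le: "tree_height (family_tree K) \<le> n" if "K \<in> size_event n" for K
    using that height_less_card[of K] by (simp add: size_event_def)
  have "AE K in conditioned_space \<mu> n. K \<in> size_event n"
    unfolding conditioned_space_def by (intro AE_uniform_measureI) auto
  then have "AE K in conditioned_space \<mu> n. norm (real (tree_height (family_tree K)) powr r) \<le> real n powr r"
    by eventually_elim (use le assms in \<open>auto intro!: powr_mono2\<close>)
  moreover have "(\<lambda>K. real (tree_height (family_tree K)) powr r) \<in> borel_measurable (conditioned_space \<mu> n)"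
    unfolding conditioned_space_def by measurable
  ultimately show ?thesis
    by (intro integrable_const_bound[where B = "real n powr r"])
qed

end

theory Submission
  imports Defs
begin

text \<open>
  Let \<open>T(z)\<close> be the generating function of \<open>P(|T| = n)\<close>, so that \<open>T = z \<phi>(T)\<close>, let \<open>\<theta> = z d/dz\<close> and
  \<open>y = z \<phi>'(T)\<close>. Pointwise, \<open>ht\<^sup>r\<close> is at most the sum of \<open>ht\<^sup>r\<close> over the subtrees at the children of
  the root, plus \<open>r ht\<^bsup>r-1\<^esup>\<close>, and summing a quantity over those subtrees multiplies its generating
  function by \<open>y\<close>. Induction on \<open>n\<close> therefore gives \<open>E[ht\<^sup>r] = O(n\<^bsup>r/2\<^esup>)\<close> for even \<open>r \<ge> 4\<close>, provided that
  the expected sum of the squared sizes of those subtrees is at most \<open>n\<^sup>2 - c n\<^bsup>3/2\<^esup>\<close>.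

  The defect is bounded below by the number of pairs of vertices whose last common ancestor is the
  root, which has generating function \<open>\<theta>T \<cdot> (\<theta>y - y)\<close>. Let \<open>p\<^sub>k\<close> be the \<open>n\<close>-th coefficient of \<open>\<theta>T \<cdot> y\<^sup>k\<close>, the
  number of vertices of depth at least \<open>k\<close>, and \<open>e\<^sub>k\<close> that of \<open>T \<cdot> y\<^sup>k \<cdot> (\<theta>y - y)\<close>. The defect is at
  least \<open>e\<^sub>0 + \<dots> + e\<^bsub>m-1\<^esub>\<close> for \<open>m \<approx> \<surd>n\<close>. Differentiating \<open>T y\<^sup>k\<close> expresses \<open>e\<^bsub>k-1\<^esub>\<close> by
  \<open>p\<^sub>k - p\<^bsub>k+1\<^esub>\<close>, which makes the sum of order \<open>n\<^bsup>1/2\<^esup> p\<^sub>0\<close> if less than half of the vertices have depth above \<open>m\<close>.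
  Otherwise \<open>e\<^sub>k \<ge> \<epsilon> p\<^sub>k - (p\<^sub>k - p\<^bsub>k+1\<^esub>)\<close> does: along the path to a random vertex not almost all
  vertices can have a single child, because \<open>d\<close> vertices with one child may be traded for one
  with \<open>d\<close> children and \<open>d - 1\<close> leaves.
\<close>

unbundle no vec_syntax
unbundle fps_syntax

section \<open>The gap in the sum of squared subtree sizes\<close>

definition fps_nonneg :: "real fps \<Rightarrow> bool" where
  "fps_nonneg f \<longleftrightarrow> (\<forall>n. 0 \<le> f $ n)"

lemma fps_nonnegD: "fps_nonneg f \<Longrightarrow> 0 \<le> f $ n"
  by (simp add: fps_nonneg_def)

lemma fps_nonneg_0: "fps_nonneg 0"
  and fps_nonneg_1: "fps_nonneg 1"
  and fps_nonneg_X: "fps_nonneg fps_X"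
  and fps_nonneg_const: "0 \<le> c \<Longrightarrow> fps_nonneg (fps_const c)"
  by (simp_all add: fps_nonneg_def fps_X_def)

lemma fps_nonneg_add: "fps_nonneg f \<Longrightarrow> fps_nonneg g \<Longrightarrow> fps_nonneg (f + g)"
  by (simp add: fps_nonneg_def)

lemma fps_nonneg_mult: "fps_nonneg f \<Longrightarrow> fps_nonneg g \<Longrightarrow> fps_nonneg (f * g)"
  by (simp add: fps_nonneg_def fps_mult_nth sum_nonneg)

lemma fps_nonneg_power: "fps_nonneg f \<Longrightarrow> fps_nonneg (f ^ k)"
  by (induction k) (simp_all add: fps_nonneg_1 fps_nonneg_mult)

lemma fps_nonneg_sum: "(\<And>i. i \<in> S \<Longrightarrow> fps_nonneg (f i)) \<Longrightarrow> fps_nonneg (\<Sum>i\<in>S. f i)"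
  by (simp add: fps_nonneg_def fps_sum_nth sum_nonneg)

lemma fps_nonneg_deriv: "fps_nonneg f \<Longrightarrow> fps_nonneg (fps_deriv f)"
  by (simp add: fps_nonneg_def)

lemma fps_nonneg_compose: "fps_nonneg f \<Longrightarrow> fps_nonneg g \<Longrightarrow> fps_nonneg (f oo g)"
  using fps_nonneg_power[of g] by (simp add: fps_nonneg_def fps_compose_nth sum_nonneg)

lemma fps_nonneg_power_mono:
  assumes "fps_nonneg f" "fps_nonneg (g - f)"
  shows "fps_nonneg (g ^ k - f ^ k)"
proof (induction k)
  case (Suc k)
  have "fps_nonneg g"
    using fps_nonneg_add[OF assms] by simp
  have "g ^ Suc k - f ^ Suc k = (g - f) * g ^ k + f * (g ^ k - f ^ k)"
    by (simp add: algebra_simps)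
  then show ?case
    using Suc assms \<open>fps_nonneg g\<close>
    by (auto intro!: fps_nonneg_add fps_nonneg_mult fps_nonneg_power)
qed (simp add: fps_nonneg_0)

text \<open>As \<open>b\<close> has no constant term, the \<open>n\<close>-th coefficient of
  \<open>b * f\<close> involves only earlier coefficients of \<open>f\<close>, so strong induction
  applies.\<close>

lemma fps_nonneg_fixpoint:
  assumes "f = v + b * f" "b $ 0 = 0" "fps_nonneg b" "fps_nonneg v"
  shows "fps_nonneg f"
proof -
  have "0 \<le> f $ n" for n
  proof (induction n rule: less_induct)
    case (less n)
    have "0 \<le> b $ i * f $ (n - i)" if "i \<in> {0..n}" for i
      using that less[of "n - i"] assms(2,3)
      by (cases "i = 0") (auto intro!: mult_nonneg_nonneg simp: fps_nonneg_def)
    then have "0 \<le> v $ n + (b * f) $ n"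
      unfolding fps_mult_nth by (intro add_nonneg_nonneg sum_nonneg fps_nonnegD[OF assms(4)])
    then show ?case
      using assms(1) by (metis fps_add_nth)
  qed
  then show ?thesis
    by (simp add: fps_nonneg_def)
qed

definition euler_deriv :: "real fps \<Rightarrow> real fps" where
  "euler_deriv f = fps_X * fps_deriv f"

lemma euler_deriv_nth: "euler_deriv f $ n = real n * f $ n"
  by (cases n) (simp_all add: euler_deriv_def)

lemma fps_nonneg_euler_deriv: "fps_nonneg f \<Longrightarrow> fps_nonneg (euler_deriv f)"
  by (simp add: fps_nonneg_def euler_deriv_nth)

lemma euler_deriv_add: "euler_deriv (f + g) = euler_deriv f + euler_deriv g"
  by (simp add: euler_deriv_def algebra_simps)

lemma euler_deriv_mult: "euler_deriv (f * g) = euler_deriv f * g + f * euler_deriv g"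
  by (simp add: euler_deriv_def algebra_simps)

lemma euler_deriv_X: "euler_deriv fps_X = fps_X"
  by (simp add: euler_deriv_def)

lemma euler_deriv_power:
  "euler_deriv (f ^ Suc k) = of_nat (Suc k) * f ^ k * euler_deriv f"
  by (induction k) (simp_all add: euler_deriv_mult algebra_simps)

lemma euler_deriv_compose:
  "g $ 0 = 0 \<Longrightarrow> euler_deriv (f oo g) = (fps_deriv f oo g) * euler_deriv g"
  by (simp add: euler_deriv_def fps_compose_deriv algebra_simps)

section \<open>Marked vertices in simply generated trees\<close>

locale simply_generated =
  fixes \<phi> T :: "real fps"
  assumes phi_nonneg: "fps_nonneg \<phi>"
    and T_nonneg: "fps_nonneg T"
    and T_eq: "T = fps_X * (\<phi> oo T)"
    and phi_1_le: "\<phi> $ 1 \<le> 1"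
begin

text \<open>
  Multiplying by \<open>spine\<close> puts a marked tree at a child of a new root; hence \<open>depth_ge n k\<close> counts, by
  weight, the trees of size \<open>n\<close> with a marked vertex of depth at least \<open>k\<close>.
\<close>

definition spine :: "real fps" where
  "spine = fps_X * (fps_deriv \<phi> oo T)"

text \<open>A root with an ordered pair of distinct children: the first is a vacant slot, as in
  \<open>spine\<close>, the second carries a subtree with a marked vertex.\<close>

definition branching :: "real fps" where
  "branching = fps_X * (fps_deriv (fps_deriv \<phi>) oo T) * euler_deriv T"

abbreviation pointed :: "real fps" where
  "pointed \<equiv> euler_deriv T"

abbreviation depth_ge :: "nat \<Rightarrow> nat \<Rightarrow> real" where
  "depth_ge n k \<equiv> (pointed * spine ^ k) $ n"

abbreviation unary :: "real fps" where
  "unary \<equiv> fps_const (\<phi> $ 1) * fps_X"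

lemma T_0: "T $ 0 = 0"
  by (subst T_eq) simp

lemma spine_0: "spine $ 0 = 0"
  by (simp add: spine_def)

lemma spine_nonneg: "fps_nonneg spine"
  unfolding spine_def
  by (intro fps_nonneg_mult fps_nonneg_X fps_nonneg_compose fps_nonneg_deriv phi_nonneg T_nonneg)

lemma pointed_nonneg: "fps_nonneg pointed"
  by (intro fps_nonneg_euler_deriv T_nonneg)

lemma branching_nonneg: "fps_nonneg branching"
  unfolding branching_def
  by (intro fps_nonneg_mult fps_nonneg_X fps_nonneg_compose fps_nonneg_deriv phi_nonneg T_nonneg
      pointed_nonneg)

text \<open>A marked vertex is the root or lies in the subtree at one child; formally,
  \<open>T_eq\<close> is differentiated.\<close>

lemma pointed_eq: "pointed = T + spine * pointed"
proof -
  have "pointed = euler_deriv (fps_X * (\<phi> oo T))"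
    using T_eq by simp
  also have "\<dots> = fps_X * (\<phi> oo T) + spine * pointed"
    by (simp add: euler_deriv_mult euler_deriv_compose[OF T_0] euler_deriv_X spine_def algebra_simps)
  finally show ?thesis
    using T_eq by simp
qed

lemma euler_deriv_spine: "euler_deriv spine = spine + branching"
  unfolding spine_def branching_def
  by (simp add: euler_deriv_mult euler_deriv_compose[OF T_0] euler_deriv_X algebra_simps)

text \<open>\<open>T * spine ^ k\<close> counts marked vertices of depth exactly
  \<open>k\<close>.\<close>

lemma T_spine_power: "T * spine ^ k = pointed * spine ^ k - pointed * spine ^ Suc k"
proof -
  have "T = pointed - spine * pointed"
    using pointed_eq by (metis add_diff_cancel_right')
  then have "T * spine ^ k = (pointed - spine * pointed) * spine ^ k"
    by simp
  then show ?thesis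
    by (simp add: algebra_simps)
qed

lemma depth_ge_nonneg: "0 \<le> depth_ge n k"
  by (intro fps_nonnegD fps_nonneg_mult fps_nonneg_power pointed_nonneg spine_nonneg)

lemma depth_ge_Suc: "depth_ge n (Suc k) = depth_ge n k - (T * spine ^ k) $ n"
  by (simp add: T_spine_power)

lemma depth_ge_Suc_le: "depth_ge n (Suc k) \<le> depth_ge n k"
  using fps_nonnegD[OF fps_nonneg_mult[OF T_nonneg fps_nonneg_power[OF spine_nonneg]], of k n]
  by (simp add: T_spine_power)

lemma depth_ge_antimono: "k \<le> m \<Longrightarrow> depth_ge n m \<le> depth_ge n k"
  by (rule lift_Suc_antimono_le[of "depth_ge n"]) (simp_all only: depth_ge_Suc_le)

lemma depth_ge_le: "depth_ge n k \<le> real n * T $ n"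
  using depth_ge_antimono[of 0 k n] by (simp add: euler_deriv_nth)

text \<open>Differentiating \<open>T * spine ^ Suc k\<close> marks a second vertex in a tree with a
  marked vertex of depth \<open>Suc k\<close>. It lies in the subtree of the first, or branches off
  at one of the \<open>Suc k\<close> proper ancestors of the first, or is such an ancestor.\<close>

lemma depth_recursion:
  "real n * (depth_ge n (Suc k) - depth_ge n (Suc (Suc k))) =
    depth_ge n (Suc k) + real (Suc k) * (T * spine ^ k * branching) $ n
      + real (Suc k) * (depth_ge n (Suc k) - depth_ge n (Suc (Suc k)))"
proof -
  have "euler_deriv (T * spine ^ Suc k) =
      pointed * spine ^ Suc k + of_nat (Suc k) * (T * spine ^ k * branching)
        + of_nat (Suc k) * (T * spine ^ Suc k)"
    by (simp only: euler_deriv_mult euler_deriv_power euler_deriv_spine) (simp add: algebra_simps)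
  from arg_cong[OF this, of "\<lambda>f. f $ n"] show ?thesis
    unfolding T_spine_power[of "Suc k"]
    by (simp only: euler_deriv_nth fps_add_nth fps_sub_nth fps_mult_of_nat_nth)
qed

text \<open>Both sides count ordered pairs of vertices below different children of the root;
  \<open>k\<close> fixes the depth of the first vertex as \<open>k + 1\<close>, and the right-hand
  side puts no limit on that depth.\<close>

lemma sum_branching_le: "(\<Sum>k<m. (T * spine ^ k * branching) $ n) \<le> (pointed * branching) $ n"
proof -
  have "pointed = (\<Sum>k<m. T * spine ^ k) + pointed * spine ^ m"
    by (induction m) (simp_all add: T_spine_power)
  then have "pointed * branching =
      (\<Sum>k<m. T * spine ^ k * branching) + pointed * spine ^ m * branching"
    by (metis distrib_right sum_distrib_right)
  then have "(pointed * branching) $ n =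
      (\<Sum>k<m. (T * spine ^ k * branching) $ n) + (pointed * spine ^ m * branching) $ n"
    by (simp add: fps_sum_nth)
  moreover have "0 \<le> (pointed * spine ^ m * branching) $ n"
    by (intro fps_nonnegD fps_nonneg_mult fps_nonneg_power pointed_nonneg spine_nonneg branching_nonneg)
  ultimately show ?thesis
    by simp
qed

text \<open>Ordered pairs of vertices that do not lie below a common child of the root: the first is
  the root, or only the second is, or they lie below different children.\<close>

lemma euler_deriv_pointed:
  "euler_deriv pointed - spine * euler_deriv pointed = pointed + pointed * spine + pointed * branching"
proof -
  have "euler_deriv pointed = euler_deriv (T + spine * pointed)"
    using pointed_eq by simp
  also have "\<dots> = pointed + (spine + branching) * pointed + spine * euler_deriv pointed"
    by (simp add: euler_deriv_add euler_deriv_mult euler_deriv_spine)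
  finally show ?thesis
    by (simp add: algebra_simps)
qed

section \<open>Trading unary chains for branching vertices\<close>

lemma spine_minus_unary_nonneg: "fps_nonneg (spine - unary)"
proof -
  have "fps_nonneg (fps_deriv \<phi> - fps_const (\<phi> $ 1))"
    using phi_nonneg by (simp add: fps_nonneg_def)
  then have "fps_nonneg (fps_X * ((fps_deriv \<phi> - fps_const (\<phi> $ 1)) oo T))"
    by (intro fps_nonneg_mult fps_nonneg_X fps_nonneg_compose T_nonneg)
  then show ?thesis
    by (simp add: fps_compose_sub_distrib spine_def algebra_simps)
qed

text \<open>A vertex with at least two children has another child beside a distinguished one:
  \<open>k * (k - 1) \<ge> k\<close> for \<open>k \<ge> 2\<close>.\<close>

lemma branching_ge: "fps_nonneg (T * branching - pointed * (spine - unary))"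
proof -
  let ?f = "fps_deriv (fps_deriv \<phi>) * fps_X - (fps_deriv \<phi> - fps_const (\<phi> $ 1))"
  have "0 \<le> ?f $ n" for n
  proof (cases n)
    case (Suc m)
    have "0 \<le> real (m + 2) * \<phi> $ (m + 2) * real m"
      using phi_nonneg by (simp add: fps_nonneg_def)
    then show ?thesis
      by (simp add: Suc fps_X_mult_right_nth algebra_simps)
  qed simp
  then have "fps_nonneg (fps_X * (?f oo T) * pointed)"
    by (intro fps_nonneg_mult fps_nonneg_X fps_nonneg_compose T_nonneg pointed_nonneg)
      (simp add: fps_nonneg_def)
  then show ?thesis
    by (simp add: fps_compose_sub_distrib fps_compose_add_distrib fps_compose_mult_distrib[OF T_0]
        fps_X_fps_compose_startby0[OF T_0] spine_def branching_def algebra_simps)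
qed

lemma T_minus_unary_nonneg: "fps_nonneg (T * (1 - unary))"
proof -
  have "fps_nonneg (\<phi> - fps_const (\<phi> $ 1) * fps_X)"
    using phi_nonneg by (simp add: fps_nonneg_def fps_X_def)
  then have "fps_nonneg (fps_X * ((\<phi> - fps_const (\<phi> $ 1) * fps_X) oo T))"
    by (intro fps_nonneg_mult fps_nonneg_X fps_nonneg_compose T_nonneg)
  also have "fps_X * ((\<phi> - fps_const (\<phi> $ 1) * fps_X) oo T) = fps_X * (\<phi> oo T) - unary * T"
    by (simp add: fps_compose_sub_distrib fps_compose_mult_distrib[OF T_0]
        fps_X_fps_compose_startby0[OF T_0] algebra_simps)
  finally show ?thesis
    using T_eq by (simp add: algebra_simps)
qed

text \<open>\<open>1 - spine\<close> factors as \<open>(1 - unary) * (1 - b)\<close> with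
  \<open>b = (spine - unary) / (1 - unary)\<close> nonnegative. As
  \<open>pointed = T / (1 - spine)\<close>, the series equals
  \<open>T * (1 - unary) / (1 - b)\<close>, which is the solution of a nonnegative fixpoint
  equation.\<close>

lemma pointed_minus_unary_nonneg: "fps_nonneg (pointed * (1 - unary) ^ 2)"
proof -
  let ?G = "inverse (1 - unary)"
  let ?b = "(spine - unary) * ?G"
  have G: "?G * (1 - unary) = 1"
    by (rule inverse_mult_eq_1) simp
  have "fps_nonneg ?G"
  proof (rule fps_nonneg_fixpoint)
    show "?G = 1 + unary * ?G"
      using G by (simp add: algebra_simps)
    show "fps_nonneg unary"
      using phi_nonneg by (intro fps_nonneg_mult fps_nonneg_X fps_nonneg_const fps_nonnegD)
  qed (simp_all add: fps_nonneg_1)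
  then have b: "fps_nonneg ?b"
    by (intro fps_nonneg_mult spine_minus_unary_nonneg)
  have "(1 - spine) * ?G = 1 - ?b"
    using G by (simp add: algebra_simps)
  moreover have "pointed * (1 - spine) = T"
    using pointed_eq by (simp add: algebra_simps)
  ultimately have *: "pointed * (1 - ?b) = T * ?G"
    by (metis mult.assoc)
  have "pointed * (1 - unary) ^ 2 * (1 - ?b) = pointed * (1 - ?b) * (1 - unary) ^ 2"
    by (simp add: mult_ac)
  also have "\<dots> = T * (1 - unary) * (?G * (1 - unary))"
    unfolding * power2_eq_square by (simp add: mult_ac)
  finally have "pointed * (1 - unary) ^ 2 * (1 - ?b) = T * (1 - unary)"
    by (simp only: G mult_1_right)
  then have expand: "pointed * (1 - unary) ^ 2 = T * (1 - unary) + ?b * (pointed * (1 - unary) ^ 2)"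
    by (simp add: algebra_simps)
  show ?thesis
    by (rule fps_nonneg_fixpoint[OF expand _ b T_minus_unary_nonneg]) (simp add: spine_0)
qed

text \<open>
  Bernoulli's inequality \<open>u\<^sup>d \<ge> 1 - d (1 - u)\<close>, which holds coefficientwise because its defect is
  divisible by \<open>(1 - u)\<^sup>2\<close>.
\<close>

lemma bernoulli_unary:
  "fps_nonneg (pointed * (unary ^ d - 1 + of_nat d * (1 - unary)))"
proof (induction d)
  case (Suc d)
  have step: "p * (u * q - 1 + (1 + c) * (1 - u)) = p * (q - 1 + c * (1 - u)) + p * ((1 - u) * (1 - u)) * r"
    if "1 - q = (1 - u) * r" for p q r u c :: "real fps"
  proof -
    have "p * (u * q - 1 + (1 + c) * (1 - u)) = p * (q - 1 + c * (1 - u)) + p * (1 - u) * (1 - q)"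
      by (simp add: algebra_simps)
    then show ?thesis
      by (simp add: that mult_ac)
  qed
  have "pointed * (unary * unary ^ d - 1 + (1 + of_nat d) * (1 - unary)) =
      pointed * (unary ^ d - 1 + of_nat d * (1 - unary)) + pointed * ((1 - unary) * (1 - unary)) * (\<Sum>i<d. unary ^ i)"
    by (rule step) (rule one_diff_power_eq)
  then have "pointed * (unary ^ Suc d - 1 + of_nat (Suc d) * (1 - unary)) =
      pointed * (unary ^ d - 1 + of_nat d * (1 - unary)) + pointed * (1 - unary) ^ 2 * (\<Sum>i<d. unary ^ i)"
    by (simp only: power_Suc of_nat_Suc power2_eq_square)
  moreover have "fps_nonneg (\<Sum>i<d. unary ^ i)"
    using phi_nonneg
    by (intro fps_nonneg_sum fps_nonneg_power fps_nonneg_mult fps_nonneg_X fps_nonneg_const fps_nonnegD)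
  from fps_nonneg_add[OF Suc fps_nonneg_mult[OF pointed_minus_unary_nonneg this]]
  have "fps_nonneg (pointed * (unary ^ d - 1 + of_nat d * (1 - unary))
      + pointed * (1 - unary) ^ 2 * (\<Sum>i<d. unary ^ i))" .
  ultimately show ?case
    by (simp only:)
qed (simp add: fps_nonneg_0)

text \<open>Keeps only roots with \<open>d\<close> children of which the \<open>d - 1\<close>
  undistinguished ones are leaves: \<open>fps_deriv \<phi>\<close> dominates its terms of degree
  \<open>0\<close> and \<open>d - 1\<close>, and \<open>T\<close> dominates its leaf term.\<close>

lemma spine_minus_unary_ge:
  assumes "2 \<le> d"
  shows "fps_nonneg (spine - unary - fps_const (real d * \<phi> $ d * (\<phi> $ 0) ^ (d - 1)) * fps_X ^ d)"
proof -
  obtain m where d: "d = Suc m" "m \<noteq> 0"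
    using assms by (cases d) auto
  let ?c = "real d * \<phi> $ d"
  have c: "0 \<le> ?c"
    using phi_nonneg by (simp add: fps_nonneg_def)
  let ?f = "fps_deriv \<phi> - fps_const (\<phi> $ 1) - fps_const ?c * fps_X ^ m"
  have "fps_nonneg ?f"
    using phi_nonneg d by (auto simp: fps_nonneg_def)
  then have 1: "fps_nonneg (fps_X * (?f oo T))"
    by (intro fps_nonneg_mult fps_nonneg_X fps_nonneg_compose T_nonneg)
  have "fps_nonneg (\<phi> - fps_const (\<phi> $ 0))"
    using phi_nonneg by (simp add: fps_nonneg_def)
  then have "fps_nonneg (fps_X * ((\<phi> - fps_const (\<phi> $ 0)) oo T))"
    by (intro fps_nonneg_mult fps_nonneg_X fps_nonneg_compose T_nonneg)
  also have "fps_X * ((\<phi> - fps_const (\<phi> $ 0)) oo T) = fps_X * (\<phi> oo T) - fps_const (\<phi> $ 0) * fps_X"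
    by (simp add: fps_compose_sub_distrib algebra_simps)
  finally have "fps_nonneg (T - fps_const (\<phi> $ 0) * fps_X)"
    using T_eq by simp
  then have "fps_nonneg (T ^ m - (fps_const (\<phi> $ 0) * fps_X) ^ m)"
    using phi_nonneg
    by (intro fps_nonneg_power_mono fps_nonneg_mult fps_nonneg_X fps_nonneg_const fps_nonnegD)
  then have 2: "fps_nonneg (fps_const ?c * fps_X * (T ^ m - (fps_const (\<phi> $ 0) * fps_X) ^ m))"
    using c by (intro fps_nonneg_mult fps_nonneg_const fps_nonneg_X)
  have "fps_nonneg (fps_X * (?f oo T) + fps_const ?c * fps_X * (T ^ m - (fps_const (\<phi> $ 0) * fps_X) ^ m))"
    by (intro fps_nonneg_add 1 2)
  also have "?f oo T = (fps_deriv \<phi> oo T) - fps_const (\<phi> $ 1) - fps_const ?c * T ^ m"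
    by (simp add: fps_compose_sub_distrib fps_compose_mult_distrib[OF T_0]
        fps_X_power_compose[OF T_0])
  also have "fps_X * ((fps_deriv \<phi> oo T) - fps_const (\<phi> $ 1) - fps_const ?c * T ^ m) + fps_const ?c * fps_X * (T ^ m - (fps_const (\<phi> $ 0) * fps_X) ^ m)
     = spine - unary - fps_const ?c * fps_const ((\<phi> $ 0) ^ m) * fps_X ^ d"
    unfolding spine_def d by (simp add: power_mult_distrib fps_const_power algebra_simps del: fps_const_mult of_nat_Suc)
  finally show ?thesis
    by (simp add: d)
qed

text \<open>By \<open>bernoulli_unary\<close>, a shortage of branching vertices on the spine,
  measured by \<open>s\<close>, forces long unary chains. These have weight proportional to
  \<open>fps_X ^ d\<close>, and \<open>\<kappa> * fps_X ^ d\<close> is dominated by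
  \<open>spine - unary\<close>, so the chains in turn force \<open>s\<close> to be large.\<close>

lemma branching_lower_bound:
  assumes d: "2 \<le> d" and \<kappa>: "\<kappa> = real d * \<phi> $ d * (\<phi> $ 0) ^ (d - 1)"
  shows "\<kappa> * depth_ge n k - \<kappa> * real d * (depth_ge n k - depth_ge n (Suc k))
    \<le> (1 + \<kappa> * real d) * (T * spine ^ k * branching) $ n"
proof -
  define s where "s = (spine ^ k * (pointed * (spine - unary))) $ n"
  define w where "w = (spine ^ k * pointed * fps_X ^ d) $ n"
  have \<kappa>0: "0 \<le> \<kappa>"
    unfolding \<kappa> using phi_nonneg by (simp add: fps_nonneg_def)
  have yk: "fps_nonneg (spine ^ k)"
    by (intro fps_nonneg_power spine_nonneg)
  have "fps_nonneg (spine ^ k * (T * branching - pointed * (spine - unary)))"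
    by (intro fps_nonneg_mult yk branching_ge)
  from fps_nonnegD[OF this, of n] have s_le: "s \<le> (T * spine ^ k * branching) $ n"
    unfolding s_def by (simp add: algebra_simps)
  have s0: "0 \<le> s"
    unfolding s_def
    by (intro fps_nonnegD fps_nonneg_mult yk spine_minus_unary_nonneg pointed_nonneg)
  have w0: "0 \<le> w"
    unfolding w_def
    by (intro fps_nonnegD fps_nonneg_mult yk pointed_nonneg fps_nonneg_power fps_nonneg_X)
  have "fps_nonneg (spine ^ k * pointed * (spine - unary - fps_const \<kappa> * fps_X ^ d))"
    unfolding \<kappa> by (intro fps_nonneg_mult yk pointed_nonneg spine_minus_unary_ge d)
  also have "spine ^ k * pointed * (spine - unary - fps_const \<kappa> * fps_X ^ d) =
      spine ^ k * (pointed * (spine - unary)) - fps_const \<kappa> * (spine ^ k * pointed * fps_X ^ d)"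
    by (simp add: algebra_simps)
  finally have "\<kappa> * w \<le> s"
    unfolding fps_nonneg_def s_def w_def
    by (simp only: fps_sub_nth fps_mult_left_const_nth diff_ge_0_iff_ge)
  moreover have "(\<phi> $ 1) ^ d * (\<kappa> * w) \<le> \<kappa> * w"
    using \<kappa>0 w0 phi_1_le fps_nonnegD[OF phi_nonneg, of 1]
    by (intro mult_left_le_one_le power_le_one mult_nonneg_nonneg zero_le_power) auto
  ultimately have *: "\<kappa> * ((\<phi> $ 1) ^ d * w) \<le> s"
    by (simp add: mult_ac)
  \<comment> \<open>The factor \<open>1 - unary\<close> splits as
    \<open>(1 - spine) + (spine - unary)\<close>: the first part yields the drop from
    \<open>depth_ge n k\<close> to \<open>depth_ge n (Suc k)\<close>, the second yields
    \<open>s\<close>.\<close>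
  have "fps_nonneg (spine ^ k * (pointed * (unary ^ d - 1 + of_nat d * (1 - unary))))"
    by (intro fps_nonneg_mult yk bernoulli_unary)
  from fps_nonnegD[OF this, of n]
  have "0 \<le> (fps_const ((\<phi> $ 1) ^ d) * (spine ^ k * pointed * fps_X ^ d) - pointed * spine ^ k + of_nat d * (pointed * spine ^ k - pointed * spine ^ Suc k + spine ^ k * (pointed * (spine - unary)))) $ n"
    by (simp add: power_mult_distrib fps_const_power algebra_simps)
  also have "\<dots> = (\<phi> $ 1) ^ d * w - depth_ge n k + real d * (depth_ge n k - depth_ge n (Suc k) + s)"
    unfolding s_def w_def
    by (simp only: fps_add_nth fps_sub_nth fps_mult_of_nat_nth fps_mult_left_const_nth)
  finally have "depth_ge n k - real d * (depth_ge n k - depth_ge n (Suc k) + s) \<le> (\<phi> $ 1) ^ d * w"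
    by simp
  from mult_left_mono[OF this \<kappa>0] *
  have "\<kappa> * depth_ge n k - \<kappa> * real d * (depth_ge n k - depth_ge n (Suc k)) \<le> (1 + \<kappa> * real d) * s"
    by (simp add: algebra_simps)
  also have "\<dots> \<le> (1 + \<kappa> * real d) * (T * spine ^ k * branching) $ n"
    using s_le \<kappa>0 by (intro mult_left_mono) auto
  finally show ?thesis .
qed


section \<open>Branching summed over depths\<close>

lemma sum_branching_shallow:
  assumes "m \<le> n" and "0 < n"
  shows "(real n - real m) * (real n * T $ n - T $ n - depth_ge n (Suc m)) - real m * (real n * T $ n)
    \<le> real m * (\<Sum>k<m. (T * spine ^ k * branching) $ n)"
proof -
  let ?p = "depth_ge n" and ?e = "\<lambda>k. (T * spine ^ k * branching) $ n"
  have e0: "0 \<le> ?e k" for k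
    by (intro fps_nonnegD fps_nonneg_mult fps_nonneg_power T_nonneg spine_nonneg branching_nonneg)
  have le: "(real n - real m) * (?p (Suc k) - ?p (Suc (Suc k))) - real n * T $ n \<le> real m * ?e k"
    if "k < m" for k
  proof -
    \<comment> \<open>\<open>depth_recursion\<close> is solved for the branching term; weakening the
      factor \<open>n - Suc k\<close> to \<open>n - m\<close> lets the sum telescope to the vertices
      of depth between 1 and \<open>m\<close>.\<close>
    have "(real n - real m) * (?p (Suc k) - ?p (Suc (Suc k)))
        \<le> (real n - real (Suc k)) * (?p (Suc k) - ?p (Suc (Suc k)))"
      using that depth_ge_Suc_le[where n = n and k = "Suc k"] by (intro mult_right_mono) auto
    also have "\<dots> = ?p (Suc k) + real (Suc k) * ?e k"
      using depth_recursion[of n k] unfolding left_diff_distrib by linarith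
    also have "\<dots> \<le> real n * T $ n + real m * ?e k"
      using that e0[of k] by (intro add_mono depth_ge_le mult_right_mono) auto
    finally show ?thesis
      by linarith
  qed
  have "(\<Sum>k<m. ?p (Suc k) - ?p (Suc (Suc k))) = ?p (Suc 0) - ?p (Suc m)"
    by (rule sum_lessThan_telescope'[of "\<lambda>k. ?p (Suc k)"])
  also have "?p (Suc 0) = real n * T $ n - T $ n"
    using depth_ge_Suc[where n = n and k = 0] by (simp add: euler_deriv_nth)
  finally have "(\<Sum>k<m. (real n - real m) * (?p (Suc k) - ?p (Suc (Suc k))) - real n * T $ n) =
      (real n - real m) * (real n * T $ n - T $ n - ?p (Suc m)) - real m * (real n * T $ n)"
    by (simp only: sum_subtractf flip: sum_distrib_left) simp
  moreover have "(\<Sum>k<m. (real n - real m) * (?p (Suc k) - ?p (Suc (Suc k))) - real n * T $ n)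
      \<le> (\<Sum>k<m. real m * ?e k)"
    by (intro sum_mono le) simp
  ultimately show ?thesis
    by (simp only: sum_distrib_left)
qed

text \<open>For each \<open>k < m\<close>, \<open>branching_lower_bound\<close> gives a fixed share
  of \<open>depth_ge n k \<ge> depth_ge n m\<close>; the losses telescope to at most
  \<open>depth_ge n 0\<close>.\<close>

lemma sum_branching_deep:
  assumes "2 \<le> d" and \<kappa>: "\<kappa> = real d * \<phi> $ d * (\<phi> $ 0) ^ (d - 1)"
  shows "\<kappa> / (1 + \<kappa> * real d) * (real m * depth_ge n m) - real n * T $ n
    \<le> (\<Sum>k<m. (T * spine ^ k * branching) $ n)"
proof -
  let ?p = "depth_ge n" and ?e = "\<lambda>k. (T * spine ^ k * branching) $ n"
  have \<kappa>0: "0 \<le> \<kappa>"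
    unfolding \<kappa> using phi_nonneg by (simp add: fps_nonneg_def)
  have le: "\<kappa> / (1 + \<kappa> * real d) * ?p m - (?p k - ?p (Suc k)) \<le> ?e k" if "k < m" for k
  proof -
    have "?p m \<le> ?p k"
      using that by (intro depth_ge_antimono less_imp_le)
    then have "\<kappa> * ?p m \<le> \<kappa> * ?p k"
      using \<kappa>0 by (intro mult_left_mono)
    \<comment> \<open>Enlarging the factor makes the coefficient of the loss equal to one after the
      division.\<close>
    moreover have "\<kappa> * real d * (?p k - ?p (Suc k)) \<le> (1 + \<kappa> * real d) * (?p k - ?p (Suc k))"
      using \<kappa>0 depth_ge_Suc_le[where n = n and k = k] by (intro mult_right_mono) auto
    ultimately have "\<kappa> * ?p m - (1 + \<kappa> * real d) * (?p k - ?p (Suc k)) \<le> (1 + \<kappa> * real d) * ?e k"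
      using branching_lower_bound[OF assms, where n = n and k = k] by linarith
    moreover have "0 < 1 + \<kappa> * real d"
      using \<kappa>0 by (intro add_pos_nonneg mult_nonneg_nonneg) auto
    ultimately have "(\<kappa> * ?p m - (1 + \<kappa> * real d) * (?p k - ?p (Suc k))) / (1 + \<kappa> * real d) \<le> ?e k"
      by (simp only: pos_divide_le_eq mult.commute)
    then show ?thesis
      using \<open>0 < 1 + \<kappa> * real d\<close> by (simp only: diff_divide_distrib) simp
  qed
  have "(\<Sum>k<m. ?p k - ?p (Suc k)) = ?p 0 - ?p m"
    by (rule sum_lessThan_telescope')
  then have "(\<Sum>k<m. \<kappa> / (1 + \<kappa> * real d) * ?p m - (?p k - ?p (Suc k))) =
      \<kappa> / (1 + \<kappa> * real d) * (real m * ?p m) - (?p 0 - ?p m)"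
    by (simp only: sum_subtractf) simp
  moreover have "(\<Sum>k<m. \<kappa> / (1 + \<kappa> * real d) * ?p m - (?p k - ?p (Suc k))) \<le> (\<Sum>k<m. ?e k)"
    by (intro sum_mono le) simp
  moreover have "?p 0 - ?p m \<le> real n * T $ n"
    using depth_ge_nonneg[where n = n and k = m] depth_ge_le[where n = n and k = 0] by linarith
  ultimately show ?thesis
    by linarith
qed

text \<open>The left-hand coefficient is the weighted sum of the squared sizes of the subtrees at
  the children of the root. By \<open>euler_deriv_pointed\<close> it suffices to bound
  \<open>n * T $ n\<close> plus the coefficient of \<open>pointed * branching\<close> from
  below.\<close>

lemma square_size_gap:
  assumes d: "2 \<le> d" "0 < \<phi> $ d" and "0 < \<phi> $ 0"
  obtains c where "0 < c" "c \<le> 1"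
    "\<And>n. (euler_deriv (euler_deriv T) * spine) $ n \<le> (real n ^ 2 - c * (real n * sqrt n)) * T $ n"
proof
  define \<kappa> where "\<kappa> = real d * \<phi> $ d * (\<phi> $ 0) ^ (d - 1)"
  define \<epsilon> where "\<epsilon> = \<kappa> / (1 + \<kappa> * real d)"
  \<comment> \<open>\<open>\<epsilon> / 4\<close> serves the deep case; \<open>1 / 10\<close> serves
    the shallow case and makes \<open>c * sqrt n \<le> 1\<close> for \<open>n < 100\<close>.\<close>
  define c where "c = min (\<epsilon> / 4) (1 / 10)"
  have "0 < \<kappa>"
    using assms by (simp add: \<kappa>_def)
  then have "0 < \<epsilon>"
    by (simp add: \<epsilon>_def add_pos_nonneg)
  then show "0 < c" "c \<le> 1"
    by (auto simp: c_def)
  fix n :: nat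
  let ?Z = "T $ n" and ?g = "(pointed * branching) $ n"
  have Z: "0 \<le> ?Z"
    by (rule fps_nonnegD[OF T_nonneg])
  have g: "0 \<le> ?g"
    by (intro fps_nonnegD fps_nonneg_mult pointed_nonneg branching_nonneg)
  have nZ: "0 \<le> real n * ?Z"
    using Z by simp
  have "c * sqrt n * (real n * ?Z) \<le> real n * ?Z + ?g"
  proof (cases "n < 100")
    case True
    then have "sqrt n \<le> 10"
      by (intro real_le_lsqrt) auto
    then have "c * sqrt n \<le> 1 / 10 * 10"
      using \<open>0 < c\<close> by (intro mult_mono) (auto simp: c_def)
    then have "c * sqrt n * (real n * ?Z) \<le> 1 * (real n * ?Z)"
      using nZ by (intro mult_right_mono) auto
    then show ?thesis
      using g by simp
  next
    case False
    define m where "m = nat \<lfloor>sqrt n\<rfloor>"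
    have "10 \<le> sqrt n"
      using False by (intro real_le_rsqrt) auto
    then have m: "real m \<le> sqrt n" "sqrt n < real m + 1" "10 \<le> m"
      unfolding m_def by (linarith, linarith, simp add: le_nat_iff le_floor_iff)
    have sq: "sqrt n * sqrt n = real n"
      by simp
    have n10: "10 * sqrt n \<le> real n"
      using mult_right_mono[OF \<open>10 \<le> sqrt n\<close>, of "sqrt n"] by simp
    have "m \<le> n"
      using m n10 by linarith
    have mpos: "0 < real m"
      using m by simp
    show ?thesis
    proof (cases "depth_ge n (Suc m) \<ge> real n * ?Z / 2")
      case True
      \<comment> \<open>\<open>Suc m\<close> levels are summed so that their number exceeds
        \<open>sqrt n\<close>.\<close>
      have "\<epsilon> * (real (Suc m) * (real n * ?Z / 2)) \<le> \<epsilon> * (real (Suc m) * depth_ge n (Suc m))"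
        using True \<open>0 < \<epsilon>\<close> by (intro mult_left_mono) auto
      also have "\<dots> \<le> real n * ?Z + ?g"
        using sum_branching_deep[OF d(1) \<kappa>_def, of "Suc m" n] sum_branching_le[where m = "Suc m" and n = n]
        unfolding \<epsilon>_def by linarith
      finally have 1: "\<epsilon> * (real (Suc m) * (real n * ?Z / 2)) \<le> real n * ?Z + ?g" .
      have "c * sqrt n \<le> \<epsilon> / 4 * real (Suc m)"
        using m \<open>0 < c\<close> by (intro mult_mono) (auto simp: c_def)
      then have "c * sqrt n * (real n * ?Z) \<le> \<epsilon> / 4 * real (Suc m) * (real n * ?Z)"
        using nZ by (intro mult_right_mono)
      also have "\<dots> \<le> \<epsilon> * (real (Suc m) * (real n * ?Z / 2))"
        using nZ \<open>0 < \<epsilon>\<close> by (simp add: field_simps)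
      finally show ?thesis
        using 1 by linarith
    next
      case False
      \<comment> \<open>Fewer than half of the vertices lie deeper than \<open>m\<close>, and the
        root is at most one hundredth of them; a share of \<open>49 / 100\<close> remains at depths
        between 1 and \<open>m\<close>.\<close>
      have "?Z \<le> real n * ?Z / 100"
        using mult_right_mono[of 100 "real n" ?Z] Z \<open>\<not> n < 100\<close> by simp
      then have "49 / 100 * (real n * ?Z) \<le> real n * ?Z - ?Z - depth_ge n (Suc m)"
        using False by linarith
      then have "(real n - real m) * (49 / 100 * (real n * ?Z))
          \<le> (real n - real m) * (real n * ?Z - ?Z - depth_ge n (Suc m))"
        using \<open>m \<le> n\<close> by (intro mult_left_mono) auto
      moreover have "(real n - real m) * (real n * ?Z - ?Z - depth_ge n (Suc m)) - real m * (real n * ?Z)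
          \<le> real m * ?g"
      proof -
        have "real m * (\<Sum>k<m. (T * spine ^ k * branching) $ n) \<le> real m * ?g"
          by (intro mult_left_mono sum_branching_le) auto
        then show ?thesis
          using sum_branching_shallow[OF \<open>m \<le> n\<close>] \<open>\<not> n < 100\<close> by linarith
      qed
      moreover have arith: "(a * b - x) * y = a * (b * y) - x * y" for a b x y :: real
        by (simp add: algebra_simps)
      ultimately have "((real n - real m) * (49 / 100) - real m) * (real n * ?Z) \<le> real m * ?g"
        using arith[of "real n - real m" "49 / 100" "real m" "real n * ?Z"] by linarith
      moreover have "real n / 10 * (real n * ?Z) \<le> ((real n - real m) * (49 / 100) - real m) * (real n * ?Z)"
        proof (rule mult_right_mono[OF _ nZ])
        \<comment> \<open>The right-hand side is then at least
          \<open>(9 / 10 * (49 / 100) - 1 / 10) * n\<close>, which exceeds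
          \<open>n / 10\<close>.\<close>
        have "10 * real m \<le> real n"
          using m(1) n10 by linarith
        then show "real n / 10 \<le> (real n - real m) * (49 / 100) - real m"
          unfolding left_diff_distrib using mpos by linarith
      qed
      moreover have "real m * (c * sqrt n * (real n * ?Z)) \<le> real n / 10 * (real n * ?Z)"
      proof -
        have "real m * (c * sqrt n) \<le> sqrt n * (1 / 10 * sqrt n)"
          using m \<open>0 < c\<close> by (intro mult_mono) (auto simp: c_def)
        also have "\<dots> = real n / 10"
          using sq by simp
        finally show ?thesis
          using mult_right_mono[OF _ nZ, of "real m * (c * sqrt n)"] by (simp only: mult.assoc)
      qed
      ultimately have "real m * (c * sqrt n * (real n * ?Z)) \<le> real m * ?g"
        by linarith
      then show ?thesis
        using mpos nZ by simp
    qed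
  qed
  moreover have "(euler_deriv pointed * spine) $ n = real n ^ 2 * ?Z - (real n * ?Z + (pointed * spine) $ n + ?g)"
    using arg_cong[OF euler_deriv_pointed, of "\<lambda>f. f $ n"]
    by (simp add: euler_deriv_nth power2_eq_square mult.commute[of spine])
  moreover have "0 \<le> (pointed * spine) $ n"
    by (intro fps_nonnegD fps_nonneg_mult pointed_nonneg spine_nonneg)
  moreover have "(real n ^ 2 - c * (real n * sqrt n)) * ?Z = real n ^ 2 * ?Z - c * sqrt n * (real n * ?Z)"
    by (simp add: algebra_simps)
  ultimately show "(euler_deriv pointed * spine) $ n \<le> (real n ^ 2 - c * (real n * sqrt n)) * ?Z"
    by linarith
qed

end

section \<open>Plane trees and their generating functions\<close>

datatype ptree = Node "ptree list"

fun tsize :: "ptree \<Rightarrow> nat" where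
  "tsize (Node ts) = Suc (sum_list (map tsize ts))"

fun weight :: "(nat \<Rightarrow> real) \<Rightarrow> ptree \<Rightarrow> real" where
  "weight f (Node ts) = f (length ts) * prod_list (map (weight f) ts)"

text \<open>The Ulam-Harris words of a tree. By \<open>inj_vertices\<close> and
  \<open>family_tree_in_range_vertices\<close> this is a bijection onto the finite family
  trees.\<close>

fun vertices :: "ptree \<Rightarrow> nat list set" where
  "vertices (Node ts) = insert [] (\<Union>i<length ts. (#) i ` (map vertices ts ! i))"

abbreviation theight :: "ptree \<Rightarrow> nat" where
  "theight t \<equiv> tree_height (vertices t)"

definition trees :: "nat \<Rightarrow> ptree set" where
  "trees n = {t. tsize t = n}"

definition forests :: "nat \<Rightarrow> nat \<Rightarrow> ptree list set" where
  "forests d n = {ts. length ts = d \<and> sum_list (map tsize ts) = n}"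

lemma trees_0: "trees 0 = {}"
proof -
  have "tsize t \<noteq> 0" for t
    by (cases t) simp
  then show ?thesis
    by (auto simp: trees_def)
qed

lemma length_le_sum_tsize: "length ts \<le> sum_list (map tsize ts)"
proof (induction ts)
  case (Cons t ts)
  have "0 < tsize t"
    by (cases t) simp
  then show ?case
    using Cons by simp
qed simp

lemma trees_Suc: "trees (Suc n) = (\<Union>d\<le>n. Node ` forests d n)"
proof (intro equalityI subsetI)
  fix t assume "t \<in> trees (Suc n)"
  then show "t \<in> (\<Union>d\<le>n. Node ` forests d n)"
    by (cases t) (use length_le_sum_tsize in \<open>auto simp: trees_def forests_def\<close>)
qed (auto simp: trees_def forests_def)

lemma forests_0: "forests 0 n = (if n = 0 then {[]} else {})"
  by (auto simp: forests_def)

lemma forests_Suc: "forests (Suc d) n = (\<Union>j\<le>n. (\<lambda>(t, ts). t # ts) ` (trees j \<times> forests d (n - j)))"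
  by (force simp: forests_def trees_def length_Suc_conv image_iff)

text \<open>Finiteness of \<open>trees\<close> and \<open>forests\<close> is mutual; the conditional
  form lets the strong induction in \<open>finite_trees\<close> appeal to smaller trees
  only.\<close>

lemma finite_forests_aux: "(\<And>j. j \<le> n \<Longrightarrow> finite (trees j)) \<Longrightarrow> finite (forests d n)"
proof (induction d arbitrary: n)
  case (Suc d)
  then show ?case
    unfolding forests_Suc by (intro finite_UN_I finite_imageI finite_cartesian_product) auto
qed (simp add: forests_0)

lemma finite_trees: "finite (trees n)"
proof (induction n rule: less_induct)
  case (less n)
  show ?case
  proof (cases n)
    case (Suc m)
    have "finite (forests d m)" for d
      by (rule finite_forests_aux) (simp add: Suc less)
    then show ?thesis
      unfolding Suc trees_Suc by (intro finite_UN_I finite_imageI) auto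
  qed (simp add: trees_0)
qed

lemma finite_forests: "finite (forests d n)"
  by (intro finite_forests_aux finite_trees)

lemma sum_forests_Suc:
  fixes F :: "ptree list \<Rightarrow> real"
  shows "(\<Sum>ts\<in>forests (Suc d) n. F ts) =
    (\<Sum>j=0..n. \<Sum>t\<in>trees j. \<Sum>ts\<in>forests d (n - j). F (t # ts))"
proof -
  have "(\<Sum>ts\<in>forests (Suc d) n. F ts) =
      (\<Sum>j\<le>n. \<Sum>ts\<in>(\<lambda>(t, ts). t # ts) ` (trees j \<times> forests d (n - j)). F ts)"
    unfolding forests_Suc
    by (rule sum.UNION_disjoint, simp, simp add: finite_trees finite_forests, auto simp: trees_def)
  also have "\<dots> = (\<Sum>j\<le>n. \<Sum>(t, ts)\<in>trees j \<times> forests d (n - j). F (t # ts))"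
    by (intro sum.cong refl, subst sum.reindex) (auto simp: inj_on_def case_prod_unfold)
  also have "\<dots> = (\<Sum>j=0..n. \<Sum>t\<in>trees j. \<Sum>ts\<in>forests d (n - j). F (t # ts))"
    by (simp add: sum.cartesian_product atMost_atLeast0)
  finally show ?thesis .
qed

lemma sum_trees_Suc:
  fixes F :: "ptree \<Rightarrow> real"
  shows "(\<Sum>t\<in>trees (Suc n). F t) = (\<Sum>d=0..n. \<Sum>ts\<in>forests d n. F (Node ts))"
proof -
  have "(\<Sum>t\<in>trees (Suc n). F t) = (\<Sum>d\<le>n. \<Sum>t\<in>Node ` forests d n. F t)"
    unfolding trees_Suc
    by (rule sum.UNION_disjoint, simp, simp add: finite_forests, auto simp: forests_def)
  also have "\<dots> = (\<Sum>d=0..n. \<Sum>ts\<in>forests d n. F (Node ts))"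
    unfolding atMost_atLeast0 by (intro sum.cong refl, subst sum.reindex) (auto simp: inj_on_def)
  finally show ?thesis .
qed

section \<open>Weighted generating functions\<close>

definition tree_gf :: "(nat \<Rightarrow> real) \<Rightarrow> (ptree \<Rightarrow> real) \<Rightarrow> real fps" where
  "tree_gf f g = Abs_fps (\<lambda>n. \<Sum>t\<in>trees n. weight f t * g t)"

lemma tree_gf_0: "tree_gf f g $ 0 = 0"
  by (simp add: tree_gf_def trees_0)

lemma weight_nonneg: "(\<And>k. 0 \<le> f k) \<Longrightarrow> 0 \<le> weight f t"
proof (induction t)
  case (Node ts)
  have "0 \<le> prod_list (map (weight f) ts)"
    using Node by (intro prod_list_nonneg) auto
  then show ?case
    using Node.prems by simp
qed

lemma sum_forests_weight:
  "(\<Sum>ts\<in>forests d n. prod_list (map (weight f) ts)) = (tree_gf f (\<lambda>_. 1) ^ d) $ n"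
proof (induction d arbitrary: n)
  case (Suc d)
  then show ?case
    by (simp add: sum_forests_Suc fps_mult_nth tree_gf_def sum_distrib_right flip: sum_distrib_left)
qed (simp add: forests_0)

text \<open>By symmetry each of the \<open>Suc d\<close> trees contributes equally. The induction
  splits off the first tree, and \<open>g\<close> is evaluated either there or in the rest.\<close>

lemma sum_forests_marked:
  "(\<Sum>ts\<in>forests (Suc d) n. prod_list (map (weight f) ts) * sum_list (map g ts)) =
    real (Suc d) * (tree_gf f g * tree_gf f (\<lambda>_. 1) ^ d) $ n"
proof (induction d arbitrary: n)
  case 0
  have "(\<Sum>ts\<in>forests (Suc 0) n. prod_list (map (weight f) ts) * sum_list (map g ts)) =
      (\<Sum>j=0..n. \<Sum>t\<in>trees j. if n - j = 0 then weight f t * g t else 0)"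
    unfolding sum_forests_Suc forests_0 by (intro sum.cong refl) simp
  also have "\<dots> = (\<Sum>j=0..n. if j = n then \<Sum>t\<in>trees j. weight f t * g t else 0)"
    by (intro sum.cong refl) auto
  finally show ?case
    by (simp add: tree_gf_def)
next
  case (Suc d)
  let ?T = "tree_gf f (\<lambda>_. 1)" and ?G = "tree_gf f g"
  have "(\<Sum>t\<in>trees j. \<Sum>ts\<in>forests (Suc d) m. weight f t * prod_list (map (weight f) ts) * (g t + sum_list (map g ts)))
      = ?G $ j * (?T ^ Suc d) $ m + ?T $ j * (real (Suc d) * (?G * ?T ^ d) $ m)" for j m
    unfolding sum_forests_weight[symmetric] Suc.IH[symmetric]
    by (simp add: tree_gf_def sum_product distrib_left sum.distrib mult_ac)
  then have "(\<Sum>ts\<in>forests (Suc (Suc d)) n. prod_list (map (weight f) ts) * sum_list (map g ts)) =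
     (?G * ?T ^ Suc d) $ n + (?T * (of_nat (Suc d) * (?G * ?T ^ d))) $ n"
    unfolding sum_forests_Suc[of _ "Suc d"]
    by (simp add: fps_mult_nth[of ?G] fps_mult_nth[of ?T] sum.distrib del: power_Suc of_nat_Suc)
  also have "?T * (of_nat (Suc d) * (?G * ?T ^ d)) = of_nat (Suc d) * (?G * ?T ^ Suc d)"
    by (simp add: mult_ac)
  finally show ?case
    by (simp only: fps_mult_of_nat_nth) (simp add: algebra_simps)
qed

text \<open>Since \<open>c ^ i\<close> vanishes below degree \<open>i\<close>, all inner sums may
  run over the same range \<open>0..n\<close>, and the sums can be swapped.\<close>

lemma fps_mult_compose_nth:
  fixes a b c :: "real fps"
  assumes "c $ 0 = 0"
  shows "(b * (a oo c)) $ n = (\<Sum>i=0..n. a $ i * (b * c ^ i) $ n)"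
proof -
  have "(a oo c) $ m = (\<Sum>i=0..n. a $ i * (c ^ i) $ m)" if "m \<le> n" for m
    unfolding fps_compose_nth
    using that startsby_zero_power_prefix[OF assms] by (intro sum.mono_neutral_left) auto
  then have "(b * (a oo c)) $ n = (\<Sum>j=0..n. b $ j * (\<Sum>i=0..n. a $ i * (c ^ i) $ (n - j)))"
    by (simp add: fps_mult_nth)
  also have "\<dots> = (\<Sum>i=0..n. a $ i * (b * c ^ i) $ n)"
    unfolding fps_mult_nth sum_distrib_left by (subst sum.swap) (simp add: mult_ac)
  finally show ?thesis .
qed

lemma tree_gf_functional_equation:
  "tree_gf f (\<lambda>_. 1) = fps_X * (Abs_fps f oo tree_gf f (\<lambda>_. 1))"
proof (rule fps_ext)
  fix n
  show "tree_gf f (\<lambda>_. 1) $ n = (fps_X * (Abs_fps f oo tree_gf f (\<lambda>_. 1))) $ n"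
  proof (cases n)
    case (Suc m)
    have "tree_gf f (\<lambda>_. 1) $ n = (\<Sum>d=0..m. \<Sum>ts\<in>forests d m. f (length ts) * prod_list (map (weight f) ts))"
      by (simp add: Suc tree_gf_def sum_trees_Suc)
    also have "\<dots> = (\<Sum>d=0..m. f d * (\<Sum>ts\<in>forests d m. prod_list (map (weight f) ts)))"
      unfolding sum_distrib_left by (intro sum.cong refl) (simp add: forests_def)
    finally show ?thesis
      by (simp add: Suc sum_forests_weight fps_compose_nth)
  qed (simp add: tree_gf_0)
qed

text \<open>The second factor is \<open>spine\<close>: it chooses one child of the root, whose
  subtree is left to \<open>g\<close>.\<close>

lemma tree_gf_sum_children:
  assumes "\<And>ts. g' (Node ts) = sum_list (map g ts)"
  shows "tree_gf f g' = tree_gf f g * (fps_X * (fps_deriv (Abs_fps f) oo tree_gf f (\<lambda>_. 1)))"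
proof (rule fps_ext)
  fix n
  let ?T = "tree_gf f (\<lambda>_. 1)" and ?G = "tree_gf f g"
  show "tree_gf f g' $ n = (?G * (fps_X * (fps_deriv (Abs_fps f) oo ?T))) $ n"
  proof (cases n)
    case (Suc m)
    have "tree_gf f g' $ n = (\<Sum>d=0..m. \<Sum>ts\<in>forests d m. f (length ts) * prod_list (map (weight f) ts) * sum_list (map g ts))"
      by (simp add: Suc tree_gf_def sum_trees_Suc assms)
    also have "\<dots> = (\<Sum>d=0..m. f d * (\<Sum>ts\<in>forests d m. prod_list (map (weight f) ts) * sum_list (map g ts)))"
      unfolding sum_distrib_left by (intro sum.cong refl) (simp add: forests_def)
    \<comment> \<open>An empty top term is added, as \<open>m + 1\<close> trees cannot have total
      size \<open>m\<close>; it makes room for the index shift of the derivative.\<close>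
    also have "\<dots> = (\<Sum>d=0..Suc m. f d * (\<Sum>ts\<in>forests d m. prod_list (map (weight f) ts) * sum_list (map g ts)))"
    proof -
      have "forests (Suc m) m = {}"
        unfolding forests_def using length_le_sum_tsize by (metis (mono_tags, lifting) Collect_empty_eq not_less_eq_eq order_refl)
      then show ?thesis
        by simp
    qed
    also have "\<dots> = (\<Sum>d=0..m. f (Suc d) * (real (Suc d) * (?G * ?T ^ d) $ m))"
      by (subst sum.atLeast0_atMost_Suc_shift) (simp add: sum_forests_marked forests_0 del: of_nat_Suc)
    also have "\<dots> = (?G * (fps_deriv (Abs_fps f) oo ?T)) $ m"
      unfolding fps_mult_compose_nth[OF tree_gf_0] by (simp add: mult_ac)
    also have "\<dots> = (?G * (fps_X * (fps_deriv (Abs_fps f) oo ?T))) $ n"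
      by (simp add: Suc mult.left_commute[of ?G])
    finally show ?thesis .
  qed (simp add: tree_gf_0)
qed

section \<open>Correspondence with family trees\<close>

lemma mem_vertices_Node:
  "[] \<in> vertices (Node ts)"
  "i # v \<in> vertices (Node ts) \<longleftrightarrow> i < length ts \<and> v \<in> vertices (ts ! i)"
  by auto

lemma Nil_mem_vertices: "[] \<in> vertices t"
  by (cases t) simp

lemma Cons_mem_family_tree_iff:
  "i # v \<in> family_tree K \<longleftrightarrow> i < K [] \<and> v \<in> family_tree (\<lambda>u. K (i # u))"
proof (induction v rule: rev_induct)
  case Nil
  show ?case
    using snoc_mem_family_tree_iff[of "[]" i K] by (simp add: family_tree.root)
next
  case (snoc j v)
  then show ?case
    using snoc_mem_family_tree_iff[of "i # v" j K] by (auto simp: snoc_mem_family_tree_iff)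
qed

text \<open>Extended by zero to all words, so that it is an offspring function from which
  \<open>family_tree\<close> regenerates the tree.\<close>

fun arity :: "ptree \<Rightarrow> nat list \<Rightarrow> nat" where
  "arity (Node ts) [] = length ts"
| "arity (Node ts) (i # v) = (if i < length ts then arity (ts ! i) v else 0)"

lemma family_tree_arity: "family_tree (arity t) = vertices t"
proof -
  have "v \<in> family_tree (arity t) \<longleftrightarrow> v \<in> vertices t" for v
  proof (induction v arbitrary: t)
    case (Cons i v)
    obtain ts where t: "t = Node ts"
      by (cases t)
    have "(\<lambda>u. arity t (i # u)) = arity (ts ! i)" if "i < length ts"
      using that by (simp add: t)
    then show ?case
      using Cons by (auto simp: Cons_mem_family_tree_iff t simp del: vertices.simps simp: mem_vertices_Node)
  qed (simp add: family_tree.root Nil_mem_vertices)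
  then show ?thesis
    by blast
qed

lemma finite_vertices: "finite (vertices t)"
  by (induction t) simp

lemma plane_tree_vertices: "plane_tree (vertices t)"
  unfolding plane_tree_def using finite_vertices family_tree_arity by metis

lemma vertices_Node: "vertices (Node ts) = insert [] (\<Union>i<length ts. (#) i ` vertices (ts ! i))"
  by simp

lemma card_vertices: "card (vertices t) = tsize t"
proof (induction t)
  case (Node ts)
  have "card (vertices (Node ts)) = Suc (card (\<Union>i<length ts. (#) i ` vertices (ts ! i)))"
    unfolding vertices_Node by (subst card_insert_disjoint) (auto simp: finite_vertices)
  also have "card (\<Union>i<length ts. (#) i ` vertices (ts ! i)) = (\<Sum>i<length ts. card ((#) i ` vertices (ts ! i)))"
    by (rule card_UN_disjoint) (auto simp: finite_vertices)
  also have "\<dots> = (\<Sum>i<length ts. tsize (ts ! i))"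
    by (intro sum.cong refl, subst card_image) (simp_all add: Node)
  finally show ?case
    by (simp add: sum_list_sum_nth atLeast0LessThan)
qed

lemma prod_vertices: "(\<Prod>v\<in>vertices t. f (arity t v)) = weight f t"
proof (induction t)
  case (Node ts)
  have "(\<Prod>v\<in>vertices (Node ts). f (arity (Node ts) v)) =
      f (length ts) * (\<Prod>v\<in>(\<Union>i<length ts. (#) i ` vertices (ts ! i)). f (arity (Node ts) v))"
    unfolding vertices_Node by (subst prod.insert) (auto simp: finite_vertices)
  also have "(\<Prod>v\<in>(\<Union>i<length ts. (#) i ` vertices (ts ! i)). f (arity (Node ts) v)) =
      (\<Prod>i<length ts. \<Prod>v\<in>(#) i ` vertices (ts ! i). f (arity (Node ts) v))"
    by (rule prod.UNION_disjoint) (auto simp: finite_vertices)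
  also have "\<dots> = (\<Prod>i<length ts. weight f (ts ! i))"
    by (intro prod.cong refl, subst prod.reindex) (simp_all add: Node)
  finally show ?case
    by (simp add: prod.list_conv_set_nth atLeast0LessThan)
qed

lemma prod_num_children: "(\<Prod>v\<in>vertices t. f (num_children (vertices t) v)) = weight f t"
  unfolding prod_vertices[symmetric]
  by (intro prod.cong refl) (metis family_tree_arity num_children_family_tree)

text \<open>The word \<open>[i]\<close> reveals whether child \<open>i\<close> exists, and the words
  starting with \<open>i\<close> determine its subtree.\<close>

lemma inj_vertices: "inj vertices"
proof (rule injI)
  fix t t' assume "vertices t = vertices t'"
  then show "t = t'"
  proof (induction t arbitrary: t')
    case (Node ts)
    obtain ts' where t': "t' = Node ts'"
      by (cases t')
    have iff: "i < length ts \<and> v \<in> vertices (ts ! i) \<longleftrightarrow> i < length ts' \<and> v \<in> vertices (ts' ! i)" for i v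
      using Node.prems unfolding t' by (metis mem_vertices_Node(2))
    have len: "i < length ts \<longleftrightarrow> i < length ts'" for i
      using iff[of i "[]"] by (simp add: Nil_mem_vertices)
    then have len: "length ts = length ts'"
      by (meson linorder_neqE_nat less_irrefl)
    have "ts ! i = ts' ! i" if "i < length ts" for i
      using that iff len by (intro Node.IH) auto
    then show ?case
      using len by (simp add: t' list_eq_iff_nth_eq)
  qed
qed

text \<open>The subtree at child \<open>i\<close> is the family tree of a shifted offspring function
  and misses the root, so induction on the number of vertices applies.\<close>

lemma family_tree_in_range_vertices:
  assumes "finite (family_tree K)"
  shows "\<exists>t. vertices t = family_tree K"
  using assms
proof (induction "card (family_tree K)" arbitrary: K rule: less_induct)
  case less
  have "\<exists>t. vertices t = family_tree (\<lambda>u. K (i # u))" if "i < K []" for i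
  proof (rule less.hyps)
    let ?F = "family_tree (\<lambda>u. K (i # u))"
    have sub: "(#) i ` ?F \<subseteq> family_tree K - {[]}"
      using that by (auto simp: Cons_mem_family_tree_iff)
    then have "finite ((#) i ` ?F)"
      using less.prems by (meson finite_Diff finite_subset)
    then show fin: "finite ?F"
      by (rule finite_imageD) simp
    have "card ?F = card ((#) i ` ?F)"
      by (simp add: card_image)
    also have "\<dots> \<le> card (family_tree K - {[]})"
      using sub less.prems by (intro card_mono) auto
    also have "\<dots> < card (family_tree K)"
      using less.prems by (intro card_Diff1_less family_tree.root)
    finally show "card ?F < card (family_tree K)" .
  qed
  then obtain s where s: "\<And>i. i < K [] \<Longrightarrow> vertices (s i) = family_tree (\<lambda>u. K (i # u))"
    by metis
  have "v \<in> vertices (Node (map s [0..<K []])) \<longleftrightarrow> v \<in> family_tree K" for v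
    by (cases v) (auto simp: mem_vertices_Node Cons_mem_family_tree_iff s family_tree.root simp del: vertices.simps)
  then show ?case
    by blast
qed

section \<open>Pointwise recursion for powers of the height\<close>

lemma length_le_theight: "v \<in> vertices t \<Longrightarrow> length v \<le> theight t"
  unfolding tree_height_def using finite_vertices by simp

lemma theight_Node_cases:
  "theight (Node ts) = 0 \<or> (\<exists>t\<in>set ts. theight (Node ts) \<le> Suc (theight t))"
proof -
  have "theight (Node ts) \<in> length ` vertices (Node ts)"
    unfolding tree_height_def using finite_vertices Nil_mem_vertices by (intro Max_in) blast+
  then obtain v where v: "v \<in> vertices (Node ts)" "length v = theight (Node ts)"
    by force
  show ?thesis
  proof (cases v)
    case (Cons i u)
    then have "i < length ts" "u \<in> vertices (ts ! i)"
      using v(1) mem_vertices_Node(2) by blast+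
    then show ?thesis
      using v(2) Cons length_le_theight by (metis Suc_le_mono length_Cons nth_mem)
  qed (use v(2) in simp)
qed

lemma Suc_power_le: "real (Suc m) ^ r \<le> real m ^ r + real r * real (Suc m) ^ (r - 1)"
proof (induction r)
  case (Suc r)
  have "real (Suc m) ^ Suc r \<le> (real m ^ r + real r * real (Suc m) ^ (r - 1)) * real (Suc m)"
    using mult_right_mono[OF Suc, of "real (Suc m)"] by (simp add: mult.commute)
  also have "\<dots> = real m ^ Suc r + real m ^ r + real r * real (Suc m) ^ r"
    by (cases r) (simp_all add: algebra_simps)
  also have "\<dots> \<le> real m ^ Suc r + real (Suc m) ^ r + real r * real (Suc m) ^ r"
    by (intro add_mono power_mono) auto
  finally show ?case
    by (simp add: algebra_simps)
qed simp

text \<open>The maximum over the children is replaced by a sum, which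
  \<open>tree_gf_sum_children\<close> can handle; the extra level costs the discrete mean value
  bound \<open>Suc_power_le\<close>.\<close>

lemma theight_power_le:
  assumes "0 < r"
  shows "real (theight (Node ts)) ^ r
    \<le> (\<Sum>t\<leftarrow>ts. real (theight t) ^ r) + real r * real (theight (Node ts)) ^ (r - 1)"
proof -
  have sum0: "0 \<le> (\<Sum>t\<leftarrow>ts. real (theight t) ^ r)"
    by (intro sum_list_nonneg) auto
  show ?thesis
  proof (cases "theight (Node ts)")
    case 0
    then show ?thesis
      using sum0 assms unfolding 0 by (auto simp: zero_power intro!: add_nonneg_nonneg)
  next
    case (Suc m)
    then obtain t where t: "t \<in> set ts" "m \<le> theight t"
      using theight_Node_cases[of ts] by auto
    then have "real m ^ r \<le> real (theight t) ^ r"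
      by (intro power_mono) auto
    also have "\<dots> \<le> (\<Sum>t\<leftarrow>ts. real (theight t) ^ r)"
      using t(1) by (intro member_le_sum_list) auto
    finally show ?thesis
      using Suc_power_le[of m r] unfolding Suc by linarith
  qed
qed

section \<open>Moments of the height\<close>

lemma size_event_eq_UN_trees: "size_event n = (\<Union>t\<in>trees n. {K. family_tree K = vertices t})"
proof (intro equalityI subsetI)
  fix K assume K: "K \<in> size_event n"
  then obtain t where t: "vertices t = family_tree K"
    using family_tree_in_range_vertices[of K] by (auto simp: size_event_def)
  then have "t \<in> trees n"
    using K by (simp add: size_event_def trees_def flip: card_vertices)
  then show "K \<in> (\<Union>t\<in>trees n. {K. family_tree K = vertices t})"
    using t by auto
next
  fix K assume "K \<in> (\<Union>t\<in>trees n. {K. family_tree K = vertices t})"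
  then show "K \<in> size_event n"
    by (auto simp: size_event_def trees_def finite_vertices card_vertices)
qed

lemma family_tree_eq_measurable: "{K. family_tree K = vertices t} \<in> sets (offspring_space \<mu>)"
proof -
  have "{K \<in> space (offspring_space \<mu>). \<forall>v\<in>vertices t. K v = num_children (vertices t) v}
      \<in> sets (offspring_space \<mu>)"
    using finite_vertices[of t] by measurable
  then show ?thesis
    by (simp add: family_tree_eq_iff[OF plane_tree_vertices])
qed

lemma prob_family_tree_eq_weight:
  "measure (offspring_space \<mu>) {K. family_tree K = vertices t} = weight (pmf \<mu>) t"
  by (simp add: prob_family_tree_eq[OF plane_tree_vertices] prod_num_children)

lemma prob_size_event:
  "measure (offspring_space \<mu>) (size_event n) = tree_gf (pmf \<mu>) (\<lambda>_. 1) $ n"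
proof -
  interpret prob_space "offspring_space \<mu>"
    by (rule prob_space_offspring_space)
  have "disjoint_family_on (\<lambda>t. {K. family_tree K = vertices t}) (trees n)"
    using inj_vertices by (auto simp: disjoint_family_on_def inj_def)
  then have "measure (offspring_space \<mu>) (size_event n) =
      (\<Sum>t\<in>trees n. measure (offspring_space \<mu>) {K. family_tree K = vertices t})"
    unfolding size_event_eq_UN_trees
    by (intro finite_measure_finite_Union finite_trees) (auto simp: family_tree_eq_measurable)
  then show ?thesis
    by (simp add: prob_family_tree_eq_weight tree_gf_def)
qed

text \<open>On the size event the integrand is a finite combination of indicators of disjoint
  events, one for each \<open>t \<in> trees n\<close>, with conditional probabilities proportional
  to the weights.\<close>

lemma integral_height_conditioned:
  fixes F :: "nat \<Rightarrow> real"
  assumes "n \<in> attainable_sizes \<mu>"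
  shows "(\<integral>K. F (tree_height (family_tree K)) \<partial>conditioned_space \<mu> n) =
    tree_gf (pmf \<mu>) (\<lambda>t. F (theight t)) $ n / tree_gf (pmf \<mu>) (\<lambda>_. 1) $ n"
proof -
  interpret M: prob_space "offspring_space \<mu>"
    by (rule prob_space_offspring_space)
  interpret N: prob_space "conditioned_space \<mu> n"
    by (rule prob_space_conditioned_space[OF assms])
  let ?E = "\<lambda>t. {K. family_tree K = vertices t}"
  have pos: "M.prob (size_event n) > 0"
    using assms by (simp add: attainable_sizes_def)
  have setsN: "?E t \<in> sets (conditioned_space \<mu> n)" for t
    by (simp add: conditioned_space_def family_tree_eq_measurable)
  have prob: "N.prob (?E t) = weight (pmf \<mu>) t / tree_gf (pmf \<mu>) (\<lambda>_. 1) $ n" if "t \<in> trees n" for t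
  proof -
    have "size_event n \<inter> ?E t = ?E t"
      using that by (auto simp: size_event_eq_UN_trees)
    then show ?thesis
      using pos unfolding conditioned_space_def
      by (subst measure_uniform_measure)
        (simp_all add: M.emeasure_eq_measure family_tree_eq_measurable prob_family_tree_eq_weight prob_size_event)
  qed
  have "AE K in conditioned_space \<mu> n. K \<in> size_event n"
    unfolding conditioned_space_def by (intro AE_uniform_measureI) auto
  then have "AE K in conditioned_space \<mu> n.
      F (tree_height (family_tree K)) = (\<Sum>t\<in>trees n. F (theight t) * indicator (?E t) K)"
  proof eventually_elim
    case (elim K)
    then obtain t where t: "t \<in> trees n" "family_tree K = vertices t"
      by (auto simp: size_event_eq_UN_trees)
    have "F (theight s) * indicator (?E s) K = (if s = t then F (theight t) else 0)" for s
      using t(2) inj_vertices by (auto simp: indicator_def inj_def)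
    then show ?case
      using t by (simp add: finite_trees)
  qed
  moreover have "(\<lambda>K. F (tree_height (family_tree K))) \<in> borel_measurable (conditioned_space \<mu> n)"
    unfolding conditioned_space_def by measurable
  moreover have "(\<lambda>K. \<Sum>t\<in>trees n. F (theight t) * indicator (?E t) K) \<in> borel_measurable (conditioned_space \<mu> n)"
    by (intro borel_measurable_sum borel_measurable_times borel_measurable_const borel_measurable_indicator setsN)
  ultimately have "(\<integral>K. F (tree_height (family_tree K)) \<partial>conditioned_space \<mu> n) =
      (\<integral>K. (\<Sum>t\<in>trees n. F (theight t) * indicator (?E t) K) \<partial>conditioned_space \<mu> n)"
    by (intro integral_cong_AE)
  also have "\<dots> = (\<Sum>t\<in>trees n. F (theight t) * N.prob (?E t))"
    by (subst Bochner_Integration.integral_sum) (simp_all add: setsN N.emeasure_eq_measure)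
  also have "\<dots> = tree_gf (pmf \<mu>) (\<lambda>t. F (theight t)) $ n / tree_gf (pmf \<mu>) (\<lambda>_. 1) $ n"
    by (simp add: prob tree_gf_def sum_divide_distrib mult.commute)
  finally show ?thesis .
qed

text \<open>Every finite tree has a leaf, which contributes the factor \<open>f 0\<close>.\<close>

lemma weight_eq_0: "f 0 = 0 \<Longrightarrow> weight f t = 0"
proof (induction t)
  case (Node ts)
  show ?case
  proof (cases ts)
    case (Cons s ss)
    then have "weight f s = 0"
      using Node by simp
    then show ?thesis
      by (simp add: Cons)
  qed (use Node.prems in simp)
qed

text \<open>Split at \<open>h = 2 * r * s / c\<close>: above it
  \<open>r \<le> c * h / (2 * s)\<close>, below it \<open>h ^ (r - 1)\<close> is at most the power
  of the threshold.\<close>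

lemma power_split_le:
  fixes h s c :: real
  assumes "0 < s" "0 < c" "0 \<le> h" "0 < r"
  shows "real r * h ^ (r - 1) \<le> c / (2 * s) * h ^ r + real r * (2 * real r / c) ^ (r - 1) * s ^ (r - 1)"
proof (cases "2 * real r / c * s \<le> h")
  case True
  then have "real r * h ^ (r - 1) \<le> c / (2 * s) * h * h ^ (r - 1)"
    using assms by (intro mult_right_mono) (auto simp: field_simps)
  also have "\<dots> = c / (2 * s) * h ^ r"
    using \<open>0 < r\<close> by (simp add: power_eq_if)
  also have "\<dots> \<le> \<dots> + real r * (2 * real r / c) ^ (r - 1) * s ^ (r - 1)"
    using assms by simp
  finally show ?thesis .
next
  case False
  then have "h ^ (r - 1) \<le> (2 * real r / c * s) ^ (r - 1)"
    using assms by (intro power_mono) auto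
  then have "real r * h ^ (r - 1) \<le> real r * (2 * real r / c) ^ (r - 1) * s ^ (r - 1)"
    unfolding power_mult_distrib mult.assoc by (rule mult_left_mono) simp
  also have "\<dots> \<le> c / (2 * s) * h ^ r + \<dots>"
    using assms by simp
  finally show ?thesis .
qed

section \<open>Even moments by induction on the size\<close>

lemma tree_gf_mono:
  assumes "\<And>k. 0 \<le> f k" and "\<And>t. t \<in> trees n \<Longrightarrow> g t \<le> g' t"
  shows "tree_gf f g $ n \<le> tree_gf f g' $ n"
  unfolding tree_gf_def using assms by (auto intro!: sum_mono mult_left_mono weight_nonneg)

lemma tree_gf_add: "tree_gf f (\<lambda>t. g t + g' t) = tree_gf f g + tree_gf f g'"
  by (rule fps_ext) (simp add: tree_gf_def distrib_left sum.distrib)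

lemma tree_gf_scale: "tree_gf f (\<lambda>t. c * g t) = fps_const c * tree_gf f g"
  by (rule fps_ext) (simp add: tree_gf_def sum_distrib_left mult_ac)

text \<open>As \<open>a \<ge> 2\<close>, \<open>j ^ a \<le> n ^ (a - 2) * j ^ 2\<close> reduces the
  induction hypothesis for subtrees of size \<open>j\<close> to squared sizes. The gap then saves a
  proportion \<open>c / sqrt n\<close>; one half absorbs each of the two terms of
  \<open>power_split_le\<close>.\<close>

lemma height_moment_bound:
  assumes \<mu>: "pmf \<mu> 0 + pmf \<mu> 1 < 1" and \<mu>0: "0 < pmf \<mu> 0" and a: "2 \<le> a"
  obtains C where "0 \<le> C"
    "\<And>n. tree_gf (pmf \<mu>) (\<lambda>t. real (theight t) ^ (2 * a)) $ n
      \<le> C * real n ^ a * tree_gf (pmf \<mu>) (\<lambda>_. 1) $ n"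
proof -
  let ?f = "pmf \<mu>"
  define T where "T = tree_gf ?f (\<lambda>_. 1)"
  have nonneg: "fps_nonneg (tree_gf ?f g)" if "\<And>t. 0 \<le> g t" for g
    using that by (simp add: fps_nonneg_def tree_gf_def sum_nonneg weight_nonneg)
  interpret simply_generated "Abs_fps ?f" T
  proof
    show "fps_nonneg (Abs_fps ?f)" "fps_nonneg T"
      by (simp_all add: T_def nonneg fps_nonneg_def tree_gf_def sum_nonneg weight_nonneg)
    show "T = fps_X * (Abs_fps ?f oo T)"
      unfolding T_def by (rule tree_gf_functional_equation)
    show "Abs_fps ?f $ 1 \<le> 1"
      by (simp add: pmf_le_1)
  qed
  have "\<exists>d\<ge>2. 0 < ?f d"
  proof (rule ccontr)
    assume "\<not> ?thesis"
    then have "k \<in> {0, 1}" if "k \<in> set_pmf \<mu>" for k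
      using pmf_positive[OF that] by (cases "2 \<le> k") auto
    then have "set_pmf \<mu> \<subseteq> {0, 1}"
      by blast
    then have "sum ?f {0, 1} = 1"
      by (intro sum_pmf_eq_1) auto
    then show False
      using \<mu> by simp
  qed
  then obtain d where "2 \<le> d" "0 < ?f d"
    by blast
  then obtain c where c: "0 < c" "c \<le> 1" and
    gap: "\<And>n. (euler_deriv (euler_deriv T) * spine) $ n \<le> (real n ^ 2 - c * (real n * sqrt n)) * T $ n"
    using square_size_gap[of d] \<mu>0 by auto
  define r where "r = 2 * a"
  define K where "K = real r * (2 * real r / c) ^ (r - 1)"
  \<comment> \<open>Chosen so that \<open>K * s ^ (r - 1)\<close> equals
    \<open>C * (c / (2 * s)) * n ^ a\<close>, half of the saving.\<close>
  define C where "C = 2 * K / c"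
  define H where "H = tree_gf ?f (\<lambda>t. real (theight t) ^ r)"
  have "0 \<le> K" "0 \<le> C"
    using c by (simp_all add: K_def C_def)
  have "0 < r"
    using a by (simp add: r_def)
  have split: "x ^ (a - 2) * x ^ 2 = x ^ a" for x :: real
    using a by (metis le_add_diff_inverse2 power_add)
  have "H $ n \<le> C * real n ^ a * T $ n" for n
  proof (induction n rule: less_induct)
    case (less n)
    show ?case
    proof (cases "n = 0")
      case False
      define s where "s = sqrt (real n)"
      have s: "1 \<le> s" "s * s = real n"
        using False by (simp_all add: s_def)
      have T0: "0 \<le> T $ n"
        by (rule fps_nonnegD[OF T_nonneg])
      define g where "g = case_ptree (\<lambda>ts. \<Sum>t\<leftarrow>ts. real (theight t) ^ r)"
      have "tree_gf ?f g = H * (fps_X * (fps_deriv (Abs_fps ?f) oo T))"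
        unfolding H_def T_def by (rule tree_gf_sum_children) (simp add: g_def)
      then have g: "tree_gf ?f g = H * spine"
        by (simp only: spine_def)
      \<comment> \<open>The trailing factor \<open>1\<close> gives the constant the shape that
        \<open>tree_gf_scale\<close> expects.\<close>
      have "real (theight t) ^ r \<le> g t + (c / (2 * s) * real (theight t) ^ r + K * s ^ (r - 1) * 1)" for t
      proof -
        have "real (theight t) ^ r \<le> g t + real r * real (theight t) ^ (r - 1)"
          using theight_power_le[OF \<open>0 < r\<close>] unfolding g_def by (cases t) (simp only: ptree.case)
        then show ?thesis
          using power_split_le[of s c "real (theight t)" r] s c \<open>0 < r\<close> unfolding K_def by linarith
      qed
      then have "H $ n \<le> tree_gf ?f (\<lambda>t. g t + (c / (2 * s) * real (theight t) ^ r + K * s ^ (r - 1) * 1)) $ n"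
        unfolding H_def by (intro tree_gf_mono) auto
      also have "\<dots> = (H * spine) $ n + c / (2 * s) * H $ n + K * s ^ (r - 1) * T $ n"
        unfolding tree_gf_add tree_gf_scale g
        by (simp only: fps_add_nth fps_mult_left_const_nth H_def T_def)
      also have "(H * spine) $ n \<le> C * real n ^ (a - 2) * ((real n ^ 2 - c * (real n * s)) * T $ n)"
      proof -
        \<comment> \<open>The induction hypothesis covers \<open>j < n\<close>; the term
          \<open>j = n\<close> vanishes because \<open>spine\<close> has no constant term.\<close>
        have "H $ j * spine $ (n - j) \<le> C * real n ^ (a - 2) * (euler_deriv (euler_deriv T) $ j * spine $ (n - j))"
          if "j \<le> n" for j
        proof (cases "j = n")
          case False
          have "real j ^ a = real j ^ (a - 2) * real j ^ 2"
            by (rule split[symmetric])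
          also have "\<dots> \<le> real n ^ (a - 2) * real j ^ 2"
            using that by (intro mult_right_mono power_mono) auto
          finally have "C * real j ^ a * T $ j \<le> C * (real n ^ (a - 2) * real j ^ 2) * T $ j"
            using \<open>0 \<le> C\<close> by (intro mult_right_mono mult_left_mono fps_nonnegD[OF T_nonneg])
          then have "H $ j \<le> C * (real n ^ (a - 2) * real j ^ 2) * T $ j"
            using less[of j] False that by simp
          from mult_right_mono[OF this fps_nonnegD[OF spine_nonneg, of "n - j"]] show ?thesis
            by (simp add: euler_deriv_nth power2_eq_square mult_ac)
        qed (simp add: spine_0)
        then have "(H * spine) $ n \<le> (\<Sum>j=0..n. C * real n ^ (a - 2) * (euler_deriv (euler_deriv T) $ j * spine $ (n - j)))"
          unfolding fps_mult_nth by (intro sum_mono) simp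
        also have "\<dots> = C * real n ^ (a - 2) * (euler_deriv (euler_deriv T) * spine) $ n"
          by (simp only: fps_mult_nth sum_distrib_left)
        also have "\<dots> \<le> C * real n ^ (a - 2) * ((real n ^ 2 - c * (real n * s)) * T $ n)"
          unfolding s_def using \<open>0 \<le> C\<close> by (intro mult_left_mono gap) simp
        finally show ?thesis .
      qed
      also have "C * real n ^ (a - 2) * ((real n ^ 2 - c * (real n * s)) * T $ n) = C * (1 - c / s) * real n ^ a * T $ n"
      proof -
        have "real n ^ 2 - c * (real n * s) = real n ^ 2 * (1 - c / s)"
          using s by (simp add: field_simps power2_eq_square)
        then show ?thesis
          unfolding split[of "real n", symmetric] by (simp only: mult_ac)
      qed
      also have "K * s ^ (r - 1) * T $ n = C * (c / (2 * s)) * real n ^ a * T $ n"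
      proof -
        have "s ^ r = real n ^ a"
          using s by (simp add: r_def power_mult power2_eq_square)
        moreover have "s ^ r = s * s ^ (r - 1)"
          using \<open>0 < r\<close> by (simp add: power_eq_if)
        ultimately show ?thesis
          using s c by (simp add: C_def field_simps)
      qed
      finally have "(1 - c / (2 * s)) * H $ n \<le> (1 - c / (2 * s)) * (C * real n ^ a * T $ n)"
        by (simp add: algebra_simps add_divide_distrib)
      moreover have "0 < 1 - c / (2 * s)"
        using s c by (simp add: field_simps)
      ultimately show ?thesis
        by (simp only: mult_le_cancel_left_pos)
    qed (simp add: H_def tree_gf_0 T_0)
  qed
  then show ?thesis
    using that[OF \<open>0 \<le> C\<close>] by (simp add: H_def T_def r_def)
qed

section \<open>Real exponents\<close>

lemma powr_le_1_plus_power: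
  fixes x r :: real
  assumes "0 \<le> x" "0 < r" "r \<le> real N"
  shows "x powr r \<le> 1 + x ^ N"
proof (cases "x \<le> 1")
  case True
  then have "x powr r \<le> 1"
    using assms by (intro powr_le1) auto
  then show ?thesis
    using assms by (simp add: add_increasing2)
next
  case False
  then have "x powr r \<le> x powr real N"
    using assms by (intro powr_mono) auto
  then show ?thesis
    using False by (simp add: powr_realpow)
qed

text \<open>After division by \<open>sqrt n\<close>, the power \<open>r\<close> of the height is at
  most one plus an even power, to which \<open>height_moment_bound\<close> applies.\<close>

lemma height_powr_bigo:
  fixes r :: real
  assumes \<mu>: "pmf \<mu> 0 + pmf \<mu> 1 < 1" and r: "0 < r"
  shows "(\<lambda>n. \<integral>K. real (tree_height (family_tree K)) powr r \<partial>conditioned_space \<mu> n)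
    \<in> O[inf at_top (principal (attainable_sizes \<mu>))](\<lambda>n. real n powr (r / 2))"
proof (cases "pmf \<mu> 0 = 0")
  \<comment> \<open>Without leaves no finite tree has positive weight, so the filter is trivial and
    the estimate vacuous.\<close>
  case True
  have "attainable_sizes \<mu> = {}"
    by (simp add: attainable_sizes_def prob_size_event tree_gf_def weight_eq_0[where f = "pmf \<mu>", OF True])
  then show ?thesis
    by (simp add: bigo_def eventually_bot gt_ex)
next
  case False
  then have \<mu>0: "0 < pmf \<mu> 0"
    by (simp add: pmf_pos)
  define a where "a = max 2 (nat \<lceil>r\<rceil>)"
  have a: "2 \<le> a" "r \<le> real (2 * a)"
    unfolding a_def by (simp, linarith)
  let ?f = "pmf \<mu>"
  let ?Z = "tree_gf ?f (\<lambda>_. 1)"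
  obtain C where C: "0 \<le> C"
    "\<And>n. tree_gf ?f (\<lambda>t. real (theight t) ^ (2 * a)) $ n \<le> C * real n ^ a * ?Z $ n"
    using height_moment_bound[OF \<mu> \<mu>0 a(1)] by blast
  have bound: "(\<integral>K. real (tree_height (family_tree K)) powr r \<partial>conditioned_space \<mu> n) \<le> (1 + C) * real n powr (r / 2)"
    if n: "n \<in> attainable_sizes \<mu>" "0 < n" for n
  proof -
    have Z: "0 < ?Z $ n"
      using n by (simp add: attainable_sizes_def prob_size_event)
    have le: "real h powr r \<le> real n powr (r / 2) * 1 + real n powr (r / 2) / real n ^ a * real h ^ (2 * a)" for h
    proof -
      have "(real h / sqrt n) powr r \<le> 1 + (real h / sqrt n) ^ (2 * a)"
        using a r by (intro powr_le_1_plus_power) auto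
      moreover have "(real h / sqrt n) ^ (2 * a) = real h ^ (2 * a) / real n ^ a"
        by (simp add: power_divide power_mult)
      moreover have "(real h / sqrt n) powr r = real h powr r / real n powr (r / 2)"
        by (simp add: powr_divide powr_half_sqrt[symmetric] powr_powr)
      ultimately have "real h powr r / real n powr (r / 2) \<le> 1 + real h ^ (2 * a) / real n ^ a"
        by (simp only:)
      then have "real h powr r \<le> (1 + real h ^ (2 * a) / real n ^ a) * real n powr (r / 2)"
        using n by (simp only: pos_divide_le_eq powr_gt_zero of_nat_0_less_iff less_irrefl_nat)
      then show ?thesis
        by (simp add: algebra_simps)
    qed
    have "tree_gf ?f (\<lambda>t. real (theight t) powr r) $ n \<le>
        tree_gf ?f (\<lambda>t. real n powr (r / 2) * 1 + real n powr (r / 2) / real n ^ a * real (theight t) ^ (2 * a)) $ n"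
      by (intro tree_gf_mono le) simp
    also have "\<dots> = real n powr (r / 2) * ?Z $ n + real n powr (r / 2) / real n ^ a
        * tree_gf ?f (\<lambda>t. real (theight t) ^ (2 * a)) $ n"
      unfolding tree_gf_add tree_gf_scale by (simp only: fps_add_nth fps_mult_left_const_nth)
    also have "\<dots> \<le> real n powr (r / 2) * ?Z $ n + real n powr (r / 2) / real n ^ a * (C * real n ^ a * ?Z $ n)"
      by (intro add_left_mono mult_left_mono C) simp
    also have "\<dots> = (1 + C) * real n powr (r / 2) * ?Z $ n"
      using n by (simp add: field_simps)
    finally show ?thesis
      unfolding integral_height_conditioned[OF n(1), of "\<lambda>h. real h powr r"]
      using Z by (simp add: pos_divide_le_eq)
  qed
  show ?thesis
  proof (rule bigoI)
    show "eventually (\<lambda>n. norm (\<integral>K. real (tree_height (family_tree K)) powr r \<partial>conditioned_space \<mu> n)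
        \<le> (1 + C) * norm (real n powr (r / 2))) (inf at_top (principal (attainable_sizes \<mu>)))"
      unfolding eventually_inf_principal
      using eventually_gt_at_top[of 0]
    proof eventually_elim
      case (elim n)
      then show ?case
        using bound[of n] by (simp add: integral_nonneg)
    qed
  qed
qed

theorem corollary4:
  fixes \<mu> :: "nat pmf"
  assumes "pmf \<mu> 0 + pmf \<mu> 1 < 1"
  shows "(\<lambda>n. \<integral>K. real (tree_height (family_tree K)) \<partial>conditioned_space \<mu> n)
      \<in> O[inf at_top (principal (attainable_sizes \<mu>))](\<lambda>n. real n powr (1 / 2))
    \<and> (\<forall>r::real. 0 < r \<longrightarrow>
        (\<lambda>n. \<integral>K. real (tree_height (family_tree K)) powr r \<partial>conditioned_space \<mu> n)
          \<in> O[inf at_top (principal (attainable_sizes \<mu>))](\<lambda>n. real n powr (r / 2)))"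
  using height_powr_bigo[OF assms] height_powr_bigo[OF assms, of 1] by simp

end
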